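(* Let $\mathscr{K}$ be an essentially small monoidal-triangulated category. The following are equivalent: (a) $\mathscr{K}$ has principal closure and compact detection; (b) the poset $t_s(\mathscr{K})$ is a bounded distributive lattice consisting of the compact elements of $T_s(\mathscr{K})$ (i.e. the elements of $t_s(\mathscr{K})$ are exactly the compact elements of $T_s(\mathscr{K})$); (c) the noncommutative Balmer spectrum $\mathrm{Spc}(\mathscr{K})$ is a spectral space whose quasi-compact open subsets are exactly the complements of supports, i.e. $K^\circ(\mathrm{Spc}(\mathscr{K}))=\{\mathrm{supp}(x)^c\mid x\in\mathscr{K}\}$. If any of these conditions hold, then there is an order-preserving bijection $$T_s(\mathscr{K})\longrightarrow \mathrm{Th}(\mathrm{Spc}(\mathscr{K})),\qquad \mathscr{I}\longmapsto\bigcup_{x\in\mathscr{I}}\mathrm{supp}(x),$$ onto the set of Thomason subsets of $\mathrm{Spc}(\mathscr{K})$.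
   Context: A monoidal-triangulated category is a triangulated category $\mathscr{K}$ with a monoidal structure $(\otimes,\mathbb{1})$, not assumed symmetric or braided, such that $\otimes$ is exact in each variable. A thick subcategory is a full triangulated subcategory closed under direct summands; a thick $\otimes$-ideal is a thick subcategory $\mathscr{I}$ with $x\otimes y,\ y\otimes x\in\mathscr{I}$ for all $x\in\mathscr{I}$, $y\in\mathscr{K}$. A proper thick $\otimes$-ideal $\mathscr{P}$ is prime if for all thick $\otimes$-ideals $\mathscr{I},\mathscr{J}$, $\mathscr{I}\otimes\mathscr{J}\subseteq\mathscr{P}$ implies $\mathscr{I}\subseteq\mathscr{P}$ or $\mathscr{J}\subseteq\mathscr{P}$. A thick $\otimes$-ideal is semiprime if it is an intersection of primes ($\mathscr{K}$ being the empty intersection). $T_s(\mathscr{K})$ is the complete lattice of semiprime thick $\otimes$-ideals ordered by inclusion; $\langle x\rangle_s$ is the smallest semiprime thick $\otimes$-ideal containing $x$; $t_s(\mathscr{K})\subseteq T_s(\mathscr{K})$ is the subposet of ideals of the form $\langle x\rangle_s$, $x\in\mathscr{K}$. An element $c$ of a complete lattice is compact if $c\le\bigvee S$ implies $c\le\bigvee S'$ for some finite $S'\subseteq S$. $\mathscr{K}$ has principal closure (is principally closed) if for all $x,y\in\mathscr{K}$ there is $z\in\mathscr{K}$ with $\langle x\rangle_s\cap\langle y\rangle_s=\langle z\rangle_s$. $\mathscr{K}$ has compact detection if for all $x\in\mathscr{K}$ there is $s_x\in\mathscr{K}$ such that for every semiprime thick $\otimes$-ideal $\mathscr{I}$: $x\in\mathscr{I}$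 if and only if $x\otimes s_x\otimes x\in\mathscr{I}$. $\mathrm{Spc}(\mathscr{K})$ is the set of prime thick $\otimes$-ideals with the topology having the sets $\mathrm{supp}(x)=\{\mathscr{P}\mid x\notin\mathscr{P}\}$, $x\in\mathscr{K}$, as a basis of closed subsets. $K^\circ(X)$ is the set of quasi-compact open subsets of $X$. A space is spectral if it is quasi-compact, $T_0$, sober (every nonempty irreducible closed subset has a unique generic point), and its quasi-compact opens form a basis closed under finite intersections. A Thomason subset is a union of closed subsets each having quasi-compact complement; $\mathrm{Th}(X)$ is the set of Thomason subsets of $X$, ordered by inclusion. *)

theory Defs
  imports "HOL-Algebra.Group" "HOL-Analysis.Abstract_Topological_Spaces"
begin

section \<open>Categories\<close>

text \<open>
  The objects and the arrows of a category form subsets of HOL types, so they are sets: every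
  category in the sense below is small, and every essentially small category is equivalent to one of
  them. Essential smallness is therefore not a separate assumption.
\<close>

record ('o, 'm) category =
  Obj :: "'o set"
  Arr :: "'m set"
  Dom :: "'m \<Rightarrow> 'o"
  Cod :: "'m \<Rightarrow> 'o"
  Ident :: "'o \<Rightarrow> 'm"
  Comp :: "'m \<Rightarrow> 'm \<Rightarrow> 'm"  (infixr "\<cdot>\<index>" 75)

definition Hom :: "('o, 'm, 'e) category_scheme \<Rightarrow> 'o \<Rightarrow> 'o \<Rightarrow> 'm set" where
  "Hom C X Y = {f \<in> Arr C. Dom C f = X \<and> Cod C f = Y}"

locale category =
  fixes C :: "('o, 'm, 'e) category_scheme" (structure)
  assumes Dom_in: "f \<in> Arr C \<Longrightarrow> Dom C f \<in> Obj C"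
    and Cod_in: "f \<in> Arr C \<Longrightarrow> Cod C f \<in> Obj C"
    and Ident_in: "X \<in> Obj C \<Longrightarrow> Ident C X \<in> Hom C X X"
    and Comp_in: "\<lbrakk>f \<in> Hom C X Y; g \<in> Hom C Y Z\<rbrakk> \<Longrightarrow> g \<cdot> f \<in> Hom C X Z"
    and Comp_Ident: "f \<in> Hom C X Y \<Longrightarrow> f \<cdot> Ident C X = f"
    and Ident_Comp: "f \<in> Hom C X Y \<Longrightarrow> Ident C Y \<cdot> f = f"
    and Comp_assoc:
      "\<lbrakk>f \<in> Hom C W X; g \<in> Hom C X Y; h \<in> Hom C Y Z\<rbrakk> \<Longrightarrow> (h \<cdot> g) \<cdot> f = h \<cdot> (g \<cdot> f)"

definition is_iso :: "('o, 'm, 'e) category_scheme \<Rightarrow> 'o \<Rightarrow> 'o \<Rightarrow> 'm \<Rightarrow> bool" where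
  "is_iso C X Y f \<longleftrightarrow> f \<in> Hom C X Y \<and>
     (\<exists>g \<in> Hom C Y X. g \<cdot>\<^bsub>C\<^esub> f = Ident C X \<and> f \<cdot>\<^bsub>C\<^esub> g = Ident C Y)"

definition isomorphic :: "('o, 'm, 'e) category_scheme \<Rightarrow> 'o \<Rightarrow> 'o \<Rightarrow> bool" where
  "isomorphic C X Y \<longleftrightarrow> (\<exists>f. is_iso C X Y f)"

definition zero_object :: "('o, 'm, 'e) category_scheme \<Rightarrow> 'o \<Rightarrow> bool" where
  "zero_object C Z \<longleftrightarrow> Z \<in> Obj C \<and>
     (\<forall>X \<in> Obj C. (\<exists>!f. f \<in> Hom C X Z) \<and> (\<exists>!f. f \<in> Hom C Z X))"


section \<open>Additive categories\<close>

record ('o, 'm) additive_category = "('o, 'm) category" +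
  Add :: "'m \<Rightarrow> 'm \<Rightarrow> 'm"  (infixl "\<oplus>\<index>" 65)
  ZeroArr :: "'o \<Rightarrow> 'o \<Rightarrow> 'm"

definition hom_group ::
  "('o, 'm, 'e) additive_category_scheme \<Rightarrow> 'o \<Rightarrow> 'o \<Rightarrow> 'm monoid" where
  "hom_group C X Y = \<lparr>carrier = Hom C X Y, monoid.mult = Add C, one = ZeroArr C X Y\<rparr>"

definition Neg :: "('o, 'm, 'e) additive_category_scheme \<Rightarrow> 'm \<Rightarrow> 'm" where
  "Neg C f = inv\<^bsub>hom_group C (Dom C f) (Cod C f)\<^esub> f"

definition biproduct ::
  "('o, 'm, 'e) additive_category_scheme \<Rightarrow>
     'o \<Rightarrow> 'o \<Rightarrow> 'o \<Rightarrow> 'm \<Rightarrow> 'm \<Rightarrow> 'm \<Rightarrow> 'm \<Rightarrow> bool" where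
  "biproduct C X Y S i j p q \<longleftrightarrow>
     i \<in> Hom C X S \<and> j \<in> Hom C Y S \<and> p \<in> Hom C S X \<and> q \<in> Hom C S Y \<and>
     p \<cdot>\<^bsub>C\<^esub> i = Ident C X \<and> q \<cdot>\<^bsub>C\<^esub> j = Ident C Y \<and>
     p \<cdot>\<^bsub>C\<^esub> j = ZeroArr C Y X \<and> q \<cdot>\<^bsub>C\<^esub> i = ZeroArr C X Y \<and>
     (i \<cdot>\<^bsub>C\<^esub> p) \<oplus>\<^bsub>C\<^esub> (j \<cdot>\<^bsub>C\<^esub> q) = Ident C S"

definition is_direct_sum :: "('o, 'm, 'e) additive_category_scheme \<Rightarrow> 'o \<Rightarrow> 'o \<Rightarrow> 'o \<Rightarrow> bool" where
  "is_direct_sum C X Y S \<longleftrightarrow> (\<exists>i j p q. biproduct C X Y S i j p q)"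

locale additive_category = category C
  for C :: "('o, 'm, 'e) additive_category_scheme" (structure) +
  assumes hom_comm_group:
      "\<lbrakk>X \<in> Obj C; Y \<in> Obj C\<rbrakk> \<Longrightarrow> comm_group (hom_group C X Y)"
    and Comp_Add_left:
      "\<lbrakk>f \<in> Hom C X Y; g \<in> Hom C Y Z; g' \<in> Hom C Y Z\<rbrakk> \<Longrightarrow>
         (g \<oplus> g') \<cdot> f = (g \<cdot> f) \<oplus> (g' \<cdot> f)"
    and Comp_Add_right:
      "\<lbrakk>f \<in> Hom C X Y; f' \<in> Hom C X Y; g \<in> Hom C Y Z\<rbrakk> \<Longrightarrow>
         g \<cdot> (f \<oplus> f') = (g \<cdot> f) \<oplus> (g \<cdot> f')"
    and zero_object_exists: "\<exists>Z. zero_object C Z"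
    and direct_sum_exists:
      "\<lbrakk>X \<in> Obj C; Y \<in> Obj C\<rbrakk> \<Longrightarrow> \<exists>S. is_direct_sum C X Y S"

definition additive_endofunctor ::
  "('o, 'm, 'e) additive_category_scheme \<Rightarrow> ('o \<Rightarrow> 'o) \<Rightarrow> ('m \<Rightarrow> 'm) \<Rightarrow> bool" where
  "additive_endofunctor C FO FA \<longleftrightarrow>
     (\<forall>X \<in> Obj C. FO X \<in> Obj C) \<and>
     (\<forall>X Y. \<forall>f \<in> Hom C X Y. FA f \<in> Hom C (FO X) (FO Y)) \<and>
     (\<forall>X \<in> Obj C. FA (Ident C X) = Ident C (FO X)) \<and>
     (\<forall>X Y Z. \<forall>f \<in> Hom C X Y. \<forall>g \<in> Hom C Y Z. FA (g \<cdot>\<^bsub>C\<^esub> f) = FA g \<cdot>\<^bsub>C\<^esub> FA f) \<and>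
     (\<forall>X Y. \<forall>f \<in> Hom C X Y. \<forall>g \<in> Hom C X Y. FA (f \<oplus>\<^bsub>C\<^esub> g) = FA f \<oplus>\<^bsub>C\<^esub> FA g)"


section \<open>Triangulated categories\<close>

text \<open>
  \<open>Dist C f g h\<close> says that \<open>f : X \<rightarrow> Y\<close>, \<open>g : Y \<rightarrow> Z\<close>, \<open>h : Z \<rightarrow> \<Sigma>X\<close> form a distinguished triangle;
  the objects are recovered from the arrows. The shift \<open>\<Sigma>\<close> is an additive auto-equivalence, not
  necessarily an automorphism; no quasi-inverse is chosen.
\<close>

record ('o, 'm) triangulated_category = "('o, 'm) additive_category" +
  ShiftO :: "'o \<Rightarrow> 'o"
  ShiftA :: "'m \<Rightarrow> 'm"
  Dist :: "'m \<Rightarrow> 'm \<Rightarrow> 'm \<Rightarrow> bool"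

definition triangle ::
  "('o, 'm, 'e) triangulated_category_scheme \<Rightarrow>
     'o \<Rightarrow> 'o \<Rightarrow> 'o \<Rightarrow> 'm \<Rightarrow> 'm \<Rightarrow> 'm \<Rightarrow> bool" where
  "triangle C X Y Z f g h \<longleftrightarrow>
     f \<in> Hom C X Y \<and> g \<in> Hom C Y Z \<and> h \<in> Hom C Z (ShiftO C X)"

definition distinguished ::
  "('o, 'm, 'e) triangulated_category_scheme \<Rightarrow>
     'o \<Rightarrow> 'o \<Rightarrow> 'o \<Rightarrow> 'm \<Rightarrow> 'm \<Rightarrow> 'm \<Rightarrow> bool" where
  "distinguished C X Y Z f g h \<longleftrightarrow> triangle C X Y Z f g h \<and> Dist C f g h"

locale triangulated_category = additive_category C
  for C :: "('o, 'm, 'e) triangulated_category_scheme" (structure) +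
  assumes Shift_additive: "additive_endofunctor C (ShiftO C) (ShiftA C)"
    and Shift_fully_faithful:
      "\<lbrakk>X \<in> Obj C; Y \<in> Obj C\<rbrakk> \<Longrightarrow>
         bij_betw (ShiftA C) (Hom C X Y) (Hom C (ShiftO C X) (ShiftO C Y))"
    and Shift_ess_surj: "Y \<in> Obj C \<Longrightarrow> \<exists>X \<in> Obj C. isomorphic C (ShiftO C X) Y"
    and Dist_triangle: "Dist C f g h \<Longrightarrow> \<exists>X Y Z. triangle C X Y Z f g h"
    and Dist_iso:
      "\<lbrakk>distinguished C X Y Z f g h; triangle C X' Y' Z' f' g' h';
        is_iso C X X' u; is_iso C Y Y' v; is_iso C Z Z' w;
        f' \<cdot> u = v \<cdot> f; g' \<cdot> v = w \<cdot> g; h' \<cdot> w = ShiftA C u \<cdot> h\<rbrakk>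
       \<Longrightarrow> Dist C f' g' h'"
    and Dist_Ident:
      "\<lbrakk>X \<in> Obj C; zero_object C Z\<rbrakk> \<Longrightarrow>
         Dist C (Ident C X) (ZeroArr C X Z) (ZeroArr C Z (ShiftO C X))"
    and cone_exists:
      "f \<in> Hom C X Y \<Longrightarrow> \<exists>Z g h. distinguished C X Y Z f g h"
    and Dist_rotate:
      "triangle C X Y Z f g h \<Longrightarrow> Dist C f g h \<longleftrightarrow> Dist C g h (Neg C (ShiftA C f))"
    and Dist_morphism:
      "\<lbrakk>distinguished C X Y Z f g h; distinguished C X' Y' Z' f' g' h';
        u \<in> Hom C X X'; v \<in> Hom C Y Y'; f' \<cdot> u = v \<cdot> f\<rbrakk>
       \<Longrightarrow> \<exists>w \<in> Hom C Z Z'. g' \<cdot> v = w \<cdot> g \<and> h' \<cdot> w = ShiftA C u \<cdot> h"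
    and octahedral:
      "\<lbrakk>distinguished C X Y U f a b; distinguished C Y Z V g c d;
        distinguished C X Z W (g \<cdot> f) e k\<rbrakk>
       \<Longrightarrow> \<exists>p q. distinguished C U W V p q (ShiftA C a \<cdot> d) \<and>
             p \<cdot> a = e \<cdot> g \<and> k \<cdot> p = b \<and> q \<cdot> e = c \<and> d \<cdot> q = ShiftA C f \<cdot> k"

definition exact_endofunctor ::
  "('o, 'm, 'e) triangulated_category_scheme \<Rightarrow> ('o \<Rightarrow> 'o) \<Rightarrow> ('m \<Rightarrow> 'm) \<Rightarrow> bool" where
  "exact_endofunctor C FO FA \<longleftrightarrow>
     additive_endofunctor C FO FA \<and>
     (\<exists>\<theta>. (\<forall>X \<in> Obj C. is_iso C (FO (ShiftO C X)) (ShiftO C (FO X)) (\<theta> X)) \<and>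
          (\<forall>X Y. \<forall>f \<in> Hom C X Y.
             ShiftA C (FA f) \<cdot>\<^bsub>C\<^esub> \<theta> X = \<theta> Y \<cdot>\<^bsub>C\<^esub> FA (ShiftA C f)) \<and>
          (\<forall>X Y Z f g h. distinguished C X Y Z f g h \<longrightarrow>
             Dist C (FA f) (FA g) (\<theta> X \<cdot>\<^bsub>C\<^esub> FA h)))"


section \<open>Monoidal-triangulated categories\<close>

record ('o, 'm) mt_category = "('o, 'm) triangulated_category" +
  TensorO :: "'o \<Rightarrow> 'o \<Rightarrow> 'o"  (infixl "\<odot>\<index>" 70)
  TensorA :: "'m \<Rightarrow> 'm \<Rightarrow> 'm"  (infixl "\<star>\<index>" 80)
  UnitO :: "'o"
  Assoc :: "'o \<Rightarrow> 'o \<Rightarrow> 'o \<Rightarrow> 'm"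
  LUnit :: "'o \<Rightarrow> 'm"
  RUnit :: "'o \<Rightarrow> 'm"

locale monoidal_category = category C
  for C :: "('o, 'm, 'e) mt_category_scheme" (structure) +
  assumes TensorO_in: "\<lbrakk>X \<in> Obj C; Y \<in> Obj C\<rbrakk> \<Longrightarrow> X \<odot> Y \<in> Obj C"
    and TensorA_in:
      "\<lbrakk>f \<in> Hom C X X'; g \<in> Hom C Y Y'\<rbrakk> \<Longrightarrow> f \<star> g \<in> Hom C (X \<odot> Y) (X' \<odot> Y')"
    and Tensor_Ident:
      "\<lbrakk>X \<in> Obj C; Y \<in> Obj C\<rbrakk> \<Longrightarrow> Ident C X \<star> Ident C Y = Ident C (X \<odot> Y)"
    and Tensor_Comp:
      "\<lbrakk>f \<in> Hom C X X'; f' \<in> Hom C X' X''; g \<in> Hom C Y Y'; g' \<in> Hom C Y' Y''\<rbrakk>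
       \<Longrightarrow> (f' \<cdot> f) \<star> (g' \<cdot> g) = (f' \<star> g') \<cdot> (f \<star> g)"
    and UnitO_in: "UnitO C \<in> Obj C"
    and Assoc_iso:
      "\<lbrakk>X \<in> Obj C; Y \<in> Obj C; Z \<in> Obj C\<rbrakk> \<Longrightarrow>
         is_iso C ((X \<odot> Y) \<odot> Z) (X \<odot> (Y \<odot> Z)) (Assoc C X Y Z)"
    and Assoc_natural:
      "\<lbrakk>f \<in> Hom C X X'; g \<in> Hom C Y Y'; h \<in> Hom C Z Z'\<rbrakk> \<Longrightarrow>
         Assoc C X' Y' Z' \<cdot> ((f \<star> g) \<star> h) = (f \<star> (g \<star> h)) \<cdot> Assoc C X Y Z"
    and LUnit_iso: "X \<in> Obj C \<Longrightarrow> is_iso C (UnitO C \<odot> X) X (LUnit C X)"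
    and LUnit_natural:
      "f \<in> Hom C X Y \<Longrightarrow> LUnit C Y \<cdot> (Ident C (UnitO C) \<star> f) = f \<cdot> LUnit C X"
    and RUnit_iso: "X \<in> Obj C \<Longrightarrow> is_iso C (X \<odot> UnitO C) X (RUnit C X)"
    and RUnit_natural:
      "f \<in> Hom C X Y \<Longrightarrow> RUnit C Y \<cdot> (f \<star> Ident C (UnitO C)) = f \<cdot> RUnit C X"
    and pentagon:
      "\<lbrakk>W \<in> Obj C; X \<in> Obj C; Y \<in> Obj C; Z \<in> Obj C\<rbrakk> \<Longrightarrow>
         (Ident C W \<star> Assoc C X Y Z) \<cdot> (Assoc C W (X \<odot> Y) Z \<cdot> (Assoc C W X Y \<star> Ident C Z))
         = Assoc C W X (Y \<odot> Z) \<cdot> Assoc C (W \<odot> X) Y Z"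
    and unit_triangle:
      "\<lbrakk>X \<in> Obj C; Y \<in> Obj C\<rbrakk> \<Longrightarrow>
         (Ident C X \<star> LUnit C Y) \<cdot> Assoc C X (UnitO C) Y = RUnit C X \<star> Ident C Y"

locale monoidal_triangulated_category = triangulated_category C + monoidal_category C
  for C :: "('o, 'm, 'e) mt_category_scheme" (structure) +
  assumes Tensor_exact_right:
      "X \<in> Obj C \<Longrightarrow> exact_endofunctor C (\<lambda>Y. X \<odot> Y) (\<lambda>f. Ident C X \<star> f)"
    and Tensor_exact_left:
      "X \<in> Obj C \<Longrightarrow> exact_endofunctor C (\<lambda>Y. Y \<odot> X) (\<lambda>f. f \<star> Ident C X)"


section \<open>Thick ideals\<close>

text \<open>A full subcategory is represented by its set of objects.\<close>

definition triangulated_subcategory ::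
  "('o, 'm, 'e) triangulated_category_scheme \<Rightarrow> 'o set \<Rightarrow> bool" where
  "triangulated_subcategory C I \<longleftrightarrow>
     I \<subseteq> Obj C \<and>
     (\<forall>Z. zero_object C Z \<longrightarrow> Z \<in> I) \<and>
     (\<forall>X Y S. is_direct_sum C X Y S \<and> X \<in> I \<and> Y \<in> I \<longrightarrow> S \<in> I) \<and>
     (\<forall>X Y. isomorphic C X Y \<and> X \<in> I \<longrightarrow> Y \<in> I) \<and>
     (\<forall>X \<in> Obj C. ShiftO C X \<in> I \<longleftrightarrow> X \<in> I) \<and>
     (\<forall>X Y Z f g h. distinguished C X Y Z f g h \<and> X \<in> I \<and> Y \<in> I \<longrightarrow> Z \<in> I)"

definition thick_subcategory ::
  "('o, 'm, 'e) triangulated_category_scheme \<Rightarrow> 'o set \<Rightarrow> bool" where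
  "thick_subcategory C I \<longleftrightarrow> triangulated_subcategory C I \<and>
     (\<forall>X Y S. is_direct_sum C X Y S \<and> S \<in> I \<longrightarrow> X \<in> I \<and> Y \<in> I)"

definition thick_ideal :: "('o, 'm, 'e) mt_category_scheme \<Rightarrow> 'o set \<Rightarrow> bool" where
  "thick_ideal C I \<longleftrightarrow> thick_subcategory C I \<and>
     (\<forall>X \<in> I. \<forall>Y \<in> Obj C. X \<odot>\<^bsub>C\<^esub> Y \<in> I \<and> Y \<odot>\<^bsub>C\<^esub> X \<in> I)"

definition tensor_set :: "('o, 'm, 'e) mt_category_scheme \<Rightarrow> 'o set \<Rightarrow> 'o set \<Rightarrow> 'o set" where
  "tensor_set C I J = {X \<odot>\<^bsub>C\<^esub> Y | X Y. X \<in> I \<and> Y \<in> J}"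

definition prime_ideal :: "('o, 'm, 'e) mt_category_scheme \<Rightarrow> 'o set \<Rightarrow> bool" where
  "prime_ideal C P \<longleftrightarrow> thick_ideal C P \<and> P \<noteq> Obj C \<and>
     (\<forall>I J. thick_ideal C I \<and> thick_ideal C J \<and> tensor_set C I J \<subseteq> P \<longrightarrow> I \<subseteq> P \<or> J \<subseteq> P)"

definition Spc :: "('o, 'm, 'e) mt_category_scheme \<Rightarrow> 'o set set" where
  "Spc C = {P. prime_ideal C P}"

definition semiprime_ideal :: "('o, 'm, 'e) mt_category_scheme \<Rightarrow> 'o set \<Rightarrow> bool" where
  "semiprime_ideal C I \<longleftrightarrow> thick_ideal C I \<and> (\<exists>S \<subseteq> Spc C. I = Obj C \<inter> \<Inter>S)"

definition semiprimes :: "('o, 'm, 'e) mt_category_scheme \<Rightarrow> 'o set set" where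
  "semiprimes C = {I. semiprime_ideal C I}"

definition semiprime_gen :: "('o, 'm, 'e) mt_category_scheme \<Rightarrow> 'o \<Rightarrow> 'o set" where
  "semiprime_gen C X = \<Inter>{I \<in> semiprimes C. X \<in> I}"

definition principal_semiprimes :: "('o, 'm, 'e) mt_category_scheme \<Rightarrow> 'o set set" where
  "principal_semiprimes C = {semiprime_gen C X | X. X \<in> Obj C}"

definition principal_closure :: "('o, 'm, 'e) mt_category_scheme \<Rightarrow> bool" where
  "principal_closure C \<longleftrightarrow>
     (\<forall>X \<in> Obj C. \<forall>Y \<in> Obj C. \<exists>Z \<in> Obj C.
        semiprime_gen C X \<inter> semiprime_gen C Y = semiprime_gen C Z)"

definition compact_detection :: "('o, 'm, 'e) mt_category_scheme \<Rightarrow> bool" where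
  "compact_detection C \<longleftrightarrow>
     (\<forall>X \<in> Obj C. \<exists>S \<in> Obj C. \<forall>I. semiprime_ideal C I \<longrightarrow>
        (X \<in> I \<longleftrightarrow> X \<odot>\<^bsub>C\<^esub> S \<odot>\<^bsub>C\<^esub> X \<in> I))"


section \<open>Order theory\<close>

definition inclusion_order :: "'a set set \<Rightarrow> 'a set gorder" where
  "inclusion_order A = \<lparr>carrier = A, eq = (=), le = (\<subseteq>)\<rparr>"

definition T_s :: "('o, 'm, 'e) mt_category_scheme \<Rightarrow> 'o set gorder" where
  "T_s C = inclusion_order (semiprimes C)"

definition t_s :: "('o, 'm, 'e) mt_category_scheme \<Rightarrow> 'o set gorder" where
  "t_s C = inclusion_order (principal_semiprimes C)"

definition compact_elements :: "('a, 'e) gorder_scheme \<Rightarrow> 'a set" where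
  "compact_elements L = {c \<in> carrier L. \<forall>S \<subseteq> carrier L. c \<sqsubseteq>\<^bsub>L\<^esub> \<Squnion>\<^bsub>L\<^esub>S \<longrightarrow>
     (\<exists>S' \<subseteq> S. finite S' \<and> c \<sqsubseteq>\<^bsub>L\<^esub> \<Squnion>\<^bsub>L\<^esub>S')}"

locale bounded_distributive_lattice = bounded_lattice L for L :: "('a, 'e) gorder_scheme" (structure) +
  assumes meet_join_distrib:
    "\<lbrakk>x \<in> carrier L; y \<in> carrier L; z \<in> carrier L\<rbrakk> \<Longrightarrow> x \<sqinter> (y \<squnion> z) = (x \<sqinter> y) \<squnion> (x \<sqinter> z)"


section \<open>Spectral spaces and Thomason subsets\<close>

definition compact_opens :: "'a topology \<Rightarrow> 'a set set" where
  "compact_opens X = {U. openin X U \<and> compactin X U}"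

definition irreducible_closedin :: "'a topology \<Rightarrow> 'a set \<Rightarrow> bool" where
  "irreducible_closedin X A \<longleftrightarrow> closedin X A \<and> A \<noteq> {} \<and>
     (\<forall>F G. closedin X F \<and> closedin X G \<and> A = F \<union> G \<longrightarrow> A = F \<or> A = G)"

definition sober_space :: "'a topology \<Rightarrow> bool" where
  "sober_space X \<longleftrightarrow>
     (\<forall>A. irreducible_closedin X A \<longrightarrow> (\<exists>!x. x \<in> topspace X \<and> X closure_of {x} = A))"

definition spectral_space :: "'a topology \<Rightarrow> bool" where
  "spectral_space X \<longleftrightarrow> compact_space X \<and> t0_space X \<and> sober_space X \<and>
     openin X = arbitrary union_of (\<lambda>U. U \<in> compact_opens X) \<and>
     (\<forall>U \<in> compact_opens X. \<forall>V \<in> compact_opens X. U \<inter> V \<in> compact_opens X)"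

definition Thomason :: "'a topology \<Rightarrow> 'a set set" where
  "Thomason X = {\<Union>\<F> | \<F>. \<forall>A \<in> \<F>. closedin X A \<and> compactin X (topspace X - A)}"


section \<open>The noncommutative Balmer spectrum\<close>

definition supp :: "('o, 'm, 'e) mt_category_scheme \<Rightarrow> 'o \<Rightarrow> 'o set set" where
  "supp C X = {P \<in> Spc C. X \<notin> P}"

definition Spc_space :: "('o, 'm, 'e) mt_category_scheme \<Rightarrow> 'o set topology" where
  "Spc_space C = topology (arbitrary union_of (\<lambda>U. \<exists>X \<in> Obj C. U = Spc C - supp C X))"

definition ideal_support :: "('o, 'm, 'e) mt_category_scheme \<Rightarrow> 'o set \<Rightarrow> 'o set set" where
  "ideal_support C I = (\<Union>X\<in>I. supp C X)"


section \<open>Well-definedness\<close>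

context monoidal_triangulated_category
begin

lemma Hom_Obj:
  assumes "f \<in> Hom C X Y"
  shows "X \<in> Obj C" "Y \<in> Obj C"
  using assms Dom_in[of f] Cod_in[of f] by (auto simp: Hom_def)

lemma direct_sum_Obj:
  assumes "is_direct_sum C X Y S"
  shows "S \<in> Obj C" "X \<in> Obj C" "Y \<in> Obj C"
proof -
  obtain i j where "i \<in> Hom C X S" "j \<in> Hom C Y S"
    using assms unfolding is_direct_sum_def biproduct_def by (elim exE conjE)
  then show "S \<in> Obj C" "X \<in> Obj C" "Y \<in> Obj C" by (simp_all add: Hom_Obj)
qed

lemma prime_zero: "P \<in> Spc C \<Longrightarrow> zero_object C Z \<Longrightarrow> Z \<in> P"
  by (simp add: Spc_def prime_ideal_def thick_ideal_def thick_subcategory_def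
      triangulated_subcategory_def)

lemma prime_direct_sum:
  assumes "P \<in> Spc C" "is_direct_sum C X Y S"
  shows "S \<in> P \<longleftrightarrow> X \<in> P \<and> Y \<in> P"
proof -
  have th: "thick_subcategory C P"
    using assms(1) by (simp add: Spc_def prime_ideal_def thick_ideal_def)
  then have "triangulated_subcategory C P" unfolding thick_subcategory_def by (rule conjunct1)
  then have "\<forall>X Y S. is_direct_sum C X Y S \<and> X \<in> P \<and> Y \<in> P \<longrightarrow> S \<in> P"
    unfolding triangulated_subcategory_def by (elim conjE)
  then have "X \<in> P \<and> Y \<in> P \<Longrightarrow> S \<in> P"
    using assms(2) by (elim allE[of _ X] allE[of _ Y] allE[of _ S] impE) (rule conjI)
  moreover have "\<forall>X Y S. is_direct_sum C X Y S \<and> S \<in> P \<longrightarrow> X \<in> P \<and> Y \<in> P"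
    using th unfolding thick_subcategory_def by (rule conjunct2)
  then have "S \<in> P \<Longrightarrow> X \<in> P \<and> Y \<in> P"
    using assms(2) by (elim allE[of _ X] allE[of _ Y] allE[of _ S] impE) (rule conjI)
  ultimately show ?thesis by (intro iffI)
qed

lemma openin_Spc_space:
  "openin (Spc_space C) = arbitrary union_of (\<lambda>U. \<exists>X \<in> Obj C. U = Spc C - supp C X)"
proof -
  have "istopology (arbitrary union_of (\<lambda>U. \<exists>X \<in> Obj C. U = Spc C - supp C X))"
  proof (rule istopology_base)
    fix U V
    assume "\<exists>X \<in> Obj C. U = Spc C - supp C X" "\<exists>X \<in> Obj C. V = Spc C - supp C X"
    then obtain X Y where XY: "X \<in> Obj C" "Y \<in> Obj C"
      "U = Spc C - supp C X" "V = Spc C - supp C Y" by blast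
    obtain S where S: "is_direct_sum C X Y S" using direct_sum_exists XY by blast
    have "U \<inter> V = Spc C - supp C S"
      using prime_direct_sum[OF _ S] by (auto simp: XY supp_def)
    then show "\<exists>X \<in> Obj C. U \<inter> V = Spc C - supp C X"
      using direct_sum_Obj(1)[OF S] by (rule bexI)
  qed
  then show ?thesis unfolding Spc_space_def by (rule topology_inverse')
qed

lemma topspace_Spc_space: "topspace (Spc_space C) = Spc C"
proof -
  obtain Z where Z: "zero_object C Z" using zero_object_exists by (elim exE)
  have "Z \<in> Obj C" using Z by (simp add: zero_object_def)
  moreover have "Spc C = Spc C - supp C Z"
    using prime_zero[OF _ Z] by (auto simp: supp_def)
  ultimately have "\<exists>X \<in> Obj C. Spc C = Spc C - supp C X" by (rule bexI[rotated])
  then have "openin (Spc_space C) (Spc C)"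
    unfolding openin_Spc_space by (rule arbitrary_union_of_inc)
  then have "Spc C \<subseteq> topspace (Spc_space C)" by (rule openin_subset)
  moreover have "topspace (Spc_space C) \<subseteq> Spc C"
  proof -
    have "openin (Spc_space C) (topspace (Spc_space C))" by (rule openin_topspace)
    then obtain \<U> where
      "\<U> \<subseteq> Collect (\<lambda>U. \<exists>X \<in> Obj C. U = Spc C - supp C X)" "\<Union>\<U> = topspace (Spc_space C)"
      unfolding openin_Spc_space union_of_def by (elim exE conjE)
    then show ?thesis by blast
  qed
  ultimately show ?thesis by (rule subset_antisym[rotated])
qed

lemma thick_ideal_Obj: "thick_ideal C (Obj C)"
proof -
  have S: "X \<in> Obj C \<Longrightarrow> ShiftO C X \<in> Obj C" for X
    using Shift_additive by (simp add: additive_endofunctor_def)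
  have I: "Y \<in> Obj C" if iso: "isomorphic C X Y" for X Y
  proof -
    obtain f where "f \<in> Hom C X Y"
      using iso unfolding isomorphic_def is_iso_def by (elim exE conjE)
    then show ?thesis by (rule Hom_Obj)
  qed
  have T: "Z \<in> Obj C" if "distinguished C X Y Z f g h" for X Y Z f g h
  proof -
    have "g \<in> Hom C Y Z" using that unfolding distinguished_def triangle_def by (elim conjE)
    then show ?thesis by (rule Hom_Obj)
  qed
  show ?thesis
    unfolding thick_ideal_def thick_subcategory_def triangulated_subcategory_def
  proof (intro conjI)
    show "\<forall>Z. zero_object C Z \<longrightarrow> Z \<in> Obj C" by (simp add: zero_object_def)
    show "\<forall>X \<in> Obj C. ShiftO C X \<in> Obj C \<longleftrightarrow> X \<in> Obj C" using S by simp
    show "\<forall>X Y Z f g h. distinguished C X Y Z f g h \<and> X \<in> Obj C \<and> Y \<in> Obj C \<longrightarrow> Z \<in> Obj C"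
      using T by blast
    show "\<forall>X \<in> Obj C. \<forall>Y \<in> Obj C. X \<odot> Y \<in> Obj C \<and> Y \<odot> X \<in> Obj C"
      using TensorO_in by simp
  qed (use direct_sum_Obj I in blast)+
qed

lemma thick_ideal_Inter:
  assumes "\<And>I. I \<in> S \<Longrightarrow> thick_ideal C I"
  shows "thick_ideal C (Obj C \<inter> \<Inter>S)"
proof -
  define T where "T = insert (Obj C) S"
  have T: "Obj C \<inter> \<Inter>S = \<Inter>T" "Obj C \<in> T" by (auto simp: T_def)
  have th: "thick_ideal C I" if "I \<in> T" for I
    using that assms thick_ideal_Obj by (auto simp: T_def)
  note defs = thick_ideal_def thick_subcategory_def triangulated_subcategory_def
  have 1: "\<Inter>T \<subseteq> Obj C" using T(2) by blast
  have 2: "Z \<in> \<Inter>T" if "zero_object C Z" for Z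
  proof
    fix I assume "I \<in> T"
    from th[OF this] that show "Z \<in> I" unfolding defs by blast
  qed
  have 3: "U \<in> \<Inter>T" if "is_direct_sum C X Y U" "X \<in> \<Inter>T" "Y \<in> \<Inter>T" for X Y U
  proof
    fix I assume I: "I \<in> T"
    then have "X \<in> I" "Y \<in> I" using that by auto
    with th[OF I] that(1) show "U \<in> I" unfolding defs by blast
  qed
  have 4: "Y \<in> \<Inter>T" if "isomorphic C X Y" "X \<in> \<Inter>T" for X Y
  proof
    fix I assume I: "I \<in> T"
    then have "X \<in> I" using that by auto
    with th[OF I] that(1) show "Y \<in> I" unfolding defs by blast
  qed
  have 5: "ShiftO C X \<in> \<Inter>T \<longleftrightarrow> X \<in> \<Inter>T" if "X \<in> Obj C" for X
  proof -
    have "ShiftO C X \<in> I \<longleftrightarrow> X \<in> I" if I: "I \<in> T" for I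
      using th[OF I] \<open>X \<in> Obj C\<close> unfolding defs by blast
    then show ?thesis by simp
  qed
  have 6: "Z \<in> \<Inter>T"
    if "distinguished C X Y Z f g h" "X \<in> \<Inter>T" "Y \<in> \<Inter>T" for X Y Z f g h
  proof
    fix I assume I: "I \<in> T"
    then have "X \<in> I" "Y \<in> I" using that by auto
    with th[OF I] that(1) show "Z \<in> I" unfolding defs by blast
  qed
  have 7: "X \<in> \<Inter>T \<and> Y \<in> \<Inter>T" if "is_direct_sum C X Y U" "U \<in> \<Inter>T" for X Y U
  proof -
    have "X \<in> I \<and> Y \<in> I" if I: "I \<in> T" for I
    proof -
      have "U \<in> I" using I \<open>U \<in> \<Inter>T\<close> by auto
      with th[OF I] \<open>is_direct_sum C X Y U\<close> show ?thesis unfolding defs by blast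
    qed
    then show ?thesis by simp
  qed
  have 8: "X \<odot> Y \<in> \<Inter>T \<and> Y \<odot> X \<in> \<Inter>T" if "X \<in> \<Inter>T" "Y \<in> Obj C" for X Y
  proof -
    have "X \<odot> Y \<in> I \<and> Y \<odot> X \<in> I" if I: "I \<in> T" for I
    proof -
      have "X \<in> I" using I \<open>X \<in> \<Inter>T\<close> by auto
      with th[OF I] \<open>Y \<in> Obj C\<close> show ?thesis unfolding defs by blast
    qed
    then show ?thesis by simp
  qed
  define J where "J = \<Inter>T"
  note J = 1 2 3 4 5 6 7 8
  have "thick_ideal C J"
    unfolding defs
  proof (intro conjI)
    show "J \<subseteq> Obj C" by (rule J(1)[folded J_def])
    show "\<forall>Z. zero_object C Z \<longrightarrow> Z \<in> J" using J(2)[folded J_def] by blast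
    show "\<forall>X Y S. is_direct_sum C X Y S \<and> X \<in> J \<and> Y \<in> J \<longrightarrow> S \<in> J"
      using J(3)[folded J_def] by blast
    show "\<forall>X Y. isomorphic C X Y \<and> X \<in> J \<longrightarrow> Y \<in> J" using J(4)[folded J_def] by blast
    show "\<forall>X \<in> Obj C. ShiftO C X \<in> J \<longleftrightarrow> X \<in> J" using J(5)[folded J_def] by blast
    show "\<forall>X Y Z f g h. distinguished C X Y Z f g h \<and> X \<in> J \<and> Y \<in> J \<longrightarrow> Z \<in> J"
      using J(6)[folded J_def] by blast
    show "\<forall>X Y S. is_direct_sum C X Y S \<and> S \<in> J \<longrightarrow> X \<in> J \<and> Y \<in> J"
      using J(7)[folded J_def] by blast
    show "\<forall>X \<in> J. \<forall>Y \<in> Obj C. X \<odot> Y \<in> J \<and> Y \<odot> X \<in> J" using J(8)[folded J_def] by blast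
  qed
  then show ?thesis by (simp only: T(1) J_def)
qed

lemma semiprime_Inter:
  assumes "\<S> \<subseteq> semiprimes C"
  shows "Obj C \<inter> \<Inter>\<S> \<in> semiprimes C"
proof -
  have "\<forall>I \<in> \<S>. \<exists>S \<subseteq> Spc C. I = Obj C \<inter> \<Inter>S"
    using assms unfolding semiprimes_def semiprime_ideal_def by blast
  then obtain s where s: "\<forall>I \<in> \<S>. s I \<subseteq> Spc C \<and> I = Obj C \<inter> \<Inter>(s I)" by metis
  have "Obj C \<inter> \<Inter>\<S> = Obj C \<inter> \<Inter>(\<Union>(s ` \<S>))"
  proof (rule Set.set_eqI)
    fix x
    have "x \<in> I \<longleftrightarrow> x \<in> Obj C \<and> (\<forall>P \<in> s I. x \<in> P)" if "I \<in> \<S>" for I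
    proof -
      have "I = Obj C \<inter> \<Inter>(s I)" using s that by blast
      then have "x \<in> I \<longleftrightarrow> x \<in> Obj C \<inter> \<Inter>(s I)" by (rule arg_cong)
      then show ?thesis by simp
    qed
    then show "x \<in> Obj C \<inter> \<Inter>\<S> \<longleftrightarrow> x \<in> Obj C \<inter> \<Inter>(\<Union>(s ` \<S>))" by auto
  qed
  moreover have "\<Union>(s ` \<S>) \<subseteq> Spc C" using s by blast
  moreover have "thick_ideal C (Obj C \<inter> \<Inter>\<S>)"
    using assms by (intro thick_ideal_Inter) (auto simp: semiprimes_def semiprime_ideal_def)
  ultimately show ?thesis unfolding semiprimes_def semiprime_ideal_def by blast
qed

lemma semiprime_subset: "I \<in> semiprimes C \<Longrightarrow> I \<subseteq> Obj C"
  by (auto simp: semiprimes_def semiprime_ideal_def)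

lemma semiprime_gen_least:
  assumes "X \<in> Obj C"
  shows "least (T_s C) (semiprime_gen C X) {I \<in> semiprimes C. X \<in> I}"
proof -
  have O: "Obj C \<in> semiprimes C" using semiprime_Inter[of "{}"] by simp
  then have "semiprime_gen C X = Obj C \<inter> \<Inter>{I \<in> semiprimes C. X \<in> I}"
    using assms unfolding semiprime_gen_def by auto
  then have "semiprime_gen C X \<in> semiprimes C"
    using semiprime_Inter[of "{I \<in> semiprimes C. X \<in> I}"] by simp
  then show ?thesis
    by (auto simp: least_def T_s_def inclusion_order_def semiprime_gen_def)
qed

end

lemma partial_order_inclusion_order: "partial_order (inclusion_order A)"
  by unfold_locales (auto simp: inclusion_order_def)

lemma (in monoidal_triangulated_category) complete_lattice_T_s: "complete_lattice (T_s C)"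
proof (rule partial_order.complete_latticeI)
  show "partial_order (T_s C)" by (simp add: T_s_def partial_order_inclusion_order)
  fix \<S> assume "\<S> \<subseteq> carrier (T_s C)"
  then have S: "\<S> \<subseteq> semiprimes C" by (simp add: T_s_def inclusion_order_def)
  have "greatest (T_s C) (Obj C \<inter> \<Inter>\<S>) (Lower (T_s C) \<S>)"
    unfolding greatest_def
  proof (intro conjI ballI)
    show "Obj C \<inter> \<Inter>\<S> \<in> Lower (T_s C) \<S>"
      using semiprime_Inter[OF S] by (auto simp: Lower_def T_s_def inclusion_order_def)
    fix I assume "I \<in> Lower (T_s C) \<S>"
    then have "I \<in> semiprimes C" "\<And>J. J \<in> \<S> \<Longrightarrow> I \<subseteq> J"
      using S by (auto simp: Lower_def T_s_def inclusion_order_def)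
    then have "I \<subseteq> Obj C \<inter> \<Inter>\<S>" using semiprime_subset by (intro Int_greatest Inf_greatest) auto
    then show "I \<sqsubseteq>\<^bsub>T_s C\<^esub> Obj C \<inter> \<Inter>\<S>" by (simp add: T_s_def inclusion_order_def)
  qed (simp add: Lower_def)
  then show "\<exists>i. greatest (T_s C) i (Lower (T_s C) \<S>)" by (rule exI)
  define \<J> where "\<J> = {J \<in> semiprimes C. \<Union>\<S> \<subseteq> J}"
  have J: "\<J> \<subseteq> semiprimes C" by (simp add: \<J>_def)
  have U: "Upper (T_s C) \<S> = \<J>"
    using S by (auto simp: Upper_def T_s_def inclusion_order_def \<J>_def)
  have "\<Union>\<S> \<subseteq> Obj C" using S semiprime_subset by (intro Sup_least) auto
  then have "\<Union>\<S> \<subseteq> Obj C \<inter> \<Inter>\<J>" by (intro Int_greatest Inf_greatest) (simp_all add: \<J>_def)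
  then have "Obj C \<inter> \<Inter>\<J> \<in> \<J>" using semiprime_Inter[OF J] unfolding \<J>_def by simp
  then have "least (T_s C) (Obj C \<inter> \<Inter>\<J>) \<J>"
    using J by (auto simp: least_def T_s_def inclusion_order_def)
  then show "\<exists>s. least (T_s C) s (Upper (T_s C) \<S>)" unfolding U by (rule exI)
qed

end

theory Submission
  imports Defs
begin

text \<open>
  Write \<open>D(x)\<close> for the set of primes containing \<open>x\<close>. Each of (a), (b), (c) is compared with the
  statement that the semiprime hull is finitary (\<open>hull_finitary\<close>): an object in the semiprime hull
  of a set lies in the hull of a finite subset.

  Compact detection implies finitarity: if \<open>x\<close> lies in no hull of a finite subset of \<open>A\<close>, then neither
  do the terms of the m-sequence \<open>x\<^sub>0 = x\<close>, \<open>x\<^sub>n\<^sub>+\<^sub>1 = x\<^sub>n \<otimes> s(x\<^sub>n) \<otimes> x\<^sub>n\<close>, and an ideal maximal among those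
  that contain \<open>A\<close> and avoid the sequence is prime. Conversely \<open>x\<close> lies in the hull of all
  \<open>x \<otimes> s \<otimes> x\<close>, hence of finitely many, and the direct sum of these \<open>s\<close> detects \<open>x\<close>. Finitarity says
  that the principal semiprimes are compact elements, which links (a) and (b).

  Given finitarity and principal closure, for all \<open>x\<close>, \<open>y\<close> a single \<open>s\<close> satisfies
  \<open>D(x \<otimes> s \<otimes> y) = D(x) \<union> D(y)\<close>. So the objects \<open>z\<close> whose \<open>D(z)\<close> is covered by finitely many
  members of a given open cover form an m-system, and a prime avoiding it witnesses compactness of
  \<open>D(x)\<close>; the generic point of an irreducible closed set of primes is its union. Conversely, in a
  sober space a filtered family of compact open sets with intersection inside an open set has a
  member inside it; this is applied to \<open>D(x) = \<Inter>\<^sub>s D(x \<otimes> s \<otimes> x)\<close>.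
\<close>

section \<open>Inverse images of thick subcategories under exact functors\<close>

context additive_category
begin

lemma Hom_objects:
  assumes "f \<in> Hom C X Y"
  shows "X \<in> Obj C" "Y \<in> Obj C"
  using assms Dom_in[of f] Cod_in[of f] by (auto simp: Hom_def)

lemma ZeroArr_in:
  assumes "X \<in> Obj C" "Y \<in> Obj C"
  shows "ZeroArr C X Y \<in> Hom C X Y"
proof -
  interpret G: comm_group "hom_group C X Y" using assms by (rule hom_comm_group)
  show ?thesis using G.one_closed by (simp add: hom_group_def)
qed

lemma ZeroArr_Add_ZeroArr:
  assumes "X \<in> Obj C" "Y \<in> Obj C"
  shows "ZeroArr C X Y \<oplus> ZeroArr C X Y = ZeroArr C X Y"
proof -
  interpret G: comm_group "hom_group C X Y" using assms by (rule hom_comm_group)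
  show ?thesis using G.l_one[OF G.one_closed] by (simp add: hom_group_def)
qed

text \<open>A group has a single idempotent, its neutral element. This identifies zero arrows after
  composition and under additive functors, where only compatibility with \<open>\<oplus>\<close> is
  given.\<close>

lemma idempotent_imp_ZeroArr:
  assumes "f \<in> Hom C X Y" "f \<oplus> f = f"
  shows "f = ZeroArr C X Y"
proof -
  interpret G: comm_group "hom_group C X Y" using Hom_objects[OF assms(1)] by (rule hom_comm_group)
  show ?thesis using G.l_cancel_one[of f f] assms by (simp add: hom_group_def)
qed

lemma ZeroArr_Comp:
  assumes "f \<in> Hom C X Y" "Z \<in> Obj C"
  shows "ZeroArr C Y Z \<cdot> f = ZeroArr C X Z"
proof (rule idempotent_imp_ZeroArr)
  note Y = Hom_objects(2)[OF assms(1)]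
  note z = ZeroArr_in[OF Y assms(2)]
  show "ZeroArr C Y Z \<cdot> f \<in> Hom C X Z" using Comp_in[OF assms(1) z] .
  show "(ZeroArr C Y Z \<cdot> f) \<oplus> (ZeroArr C Y Z \<cdot> f) = ZeroArr C Y Z \<cdot> f"
    using Comp_Add_left[OF assms(1) z z] ZeroArr_Add_ZeroArr[OF Y assms(2)] by simp
qed

lemma Comp_ZeroArr:
  assumes "f \<in> Hom C Y Z" "X \<in> Obj C"
  shows "f \<cdot> ZeroArr C X Y = ZeroArr C X Z"
proof (rule idempotent_imp_ZeroArr)
  note Y = Hom_objects(1)[OF assms(1)]
  note z = ZeroArr_in[OF assms(2) Y]
  show "f \<cdot> ZeroArr C X Y \<in> Hom C X Z" using Comp_in[OF z assms(1)] .
  show "(f \<cdot> ZeroArr C X Y) \<oplus> (f \<cdot> ZeroArr C X Y) = f \<cdot> ZeroArr C X Y"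
    using Comp_Add_right[OF z z assms(1)] ZeroArr_Add_ZeroArr[OF assms(2) Y] by simp
qed

text \<open>The universal property becomes one equation between arrows, which additive functors
  preserve.\<close>

lemma zero_object_iff: "zero_object C Z \<longleftrightarrow> Z \<in> Obj C \<and> Ident C Z = ZeroArr C Z Z"
proof
  assume Z: "zero_object C Z"
  then have O: "Z \<in> Obj C" by (simp add: zero_object_def)
  with Z have "\<exists>!f. f \<in> Hom C Z Z" by (simp add: zero_object_def)
  with Ident_in[OF O] ZeroArr_in[OF O O] O show "Z \<in> Obj C \<and> Ident C Z = ZeroArr C Z Z" by blast
next
  assume *: "Z \<in> Obj C \<and> Ident C Z = ZeroArr C Z Z"
  show "zero_object C Z"
    unfolding zero_object_def
  proof (intro conjI ballI)
    fix X assume X: "X \<in> Obj C"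
    have "f = ZeroArr C X Z" if f: "f \<in> Hom C X Z" for f
      using Ident_Comp[OF f] ZeroArr_Comp[OF f, of Z] * by simp
    then show "\<exists>!f. f \<in> Hom C X Z" using ZeroArr_in[OF X, of Z] * by blast
    have "f = ZeroArr C Z X" if f: "f \<in> Hom C Z X" for f
      using Comp_Ident[OF f] Comp_ZeroArr[OF f, of Z] * by simp
    then show "\<exists>!f. f \<in> Hom C Z X" using ZeroArr_in[OF _ X, of Z] * by blast
  qed (use * in simp)
qed

lemma isomorphic_sym: "isomorphic C X Y \<Longrightarrow> isomorphic C Y X"
  unfolding isomorphic_def is_iso_def by blast

lemma isomorphic_objects: "isomorphic C X Y \<Longrightarrow> X \<in> Obj C" "isomorphic C X Y \<Longrightarrow> Y \<in> Obj C"
  unfolding isomorphic_def is_iso_def by (meson Hom_objects)+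

lemma direct_sum_objects:
  assumes "is_direct_sum C X Y S"
  shows "X \<in> Obj C" "Y \<in> Obj C" "S \<in> Obj C"
  using assms Hom_objects unfolding is_direct_sum_def biproduct_def by blast+

end

section \<open>Preservation properties of additive endofunctors\<close>

context
  fixes C :: "('o, 'm, 'e) additive_category_scheme" (structure) and FO FA
  assumes C: "additive_category C" and F: "additive_endofunctor C FO FA"
begin

interpretation additive_category C by (rule C)

lemma additive_endofunctor_ZeroArr:
  assumes "X \<in> Obj C" "Y \<in> Obj C"
  shows "FA (ZeroArr C X Y) = ZeroArr C (FO X) (FO Y)"
proof (rule idempotent_imp_ZeroArr)
  note z = ZeroArr_in[OF assms]
  show "FA (ZeroArr C X Y) \<in> Hom C (FO X) (FO Y)"
    using F z unfolding additive_endofunctor_def by blast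
  have "FA (ZeroArr C X Y \<oplus> ZeroArr C X Y) = FA (ZeroArr C X Y) \<oplus> FA (ZeroArr C X Y)"
    using F z unfolding additive_endofunctor_def by blast
  then show "FA (ZeroArr C X Y) \<oplus> FA (ZeroArr C X Y) = FA (ZeroArr C X Y)"
    using ZeroArr_Add_ZeroArr[OF assms] by simp
qed

lemma additive_endofunctor_zero_object: "zero_object C Z \<Longrightarrow> zero_object C (FO Z)"
  using F additive_endofunctor_ZeroArr[of Z Z]
  unfolding zero_object_iff additive_endofunctor_def by metis

lemma additive_endofunctor_direct_sum:
  assumes "is_direct_sum C X Y S"
  shows "is_direct_sum C (FO X) (FO Y) (FO S)"
proof -
  obtain i j p q where b: "biproduct C X Y S i j p q"
    using assms unfolding is_direct_sum_def by blast
  then have h: "i \<in> Hom C X S" "j \<in> Hom C Y S" "p \<in> Hom C S X" "q \<in> Hom C S Y"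
    and e: "p \<cdot> i = Ident C X" "q \<cdot> j = Ident C Y" "p \<cdot> j = ZeroArr C Y X" "q \<cdot> i = ZeroArr C X Y"
      "(i \<cdot> p) \<oplus> (j \<cdot> q) = Ident C S"
    unfolding biproduct_def by auto
  note O = direct_sum_objects[OF assms]
  have FHom: "\<And>f X Y. f \<in> Hom C X Y \<Longrightarrow> FA f \<in> Hom C (FO X) (FO Y)"
    and FComp: "\<And>f g X Y Z. f \<in> Hom C X Y \<Longrightarrow> g \<in> Hom C Y Z \<Longrightarrow> FA (g \<cdot> f) = FA g \<cdot> FA f"
    and FIdent: "\<And>X. X \<in> Obj C \<Longrightarrow> FA (Ident C X) = Ident C (FO X)"
    and FAdd: "\<And>f g X Y. f \<in> Hom C X Y \<Longrightarrow> g \<in> Hom C X Y \<Longrightarrow> FA (f \<oplus> g) = FA f \<oplus> FA g"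
    using F unfolding additive_endofunctor_def by blast+
  have "FA (i \<cdot> p) \<oplus> FA (j \<cdot> q) = Ident C (FO S)"
    using FAdd[OF Comp_in[OF h(3,1)] Comp_in[OF h(4,2)]] e(5) FIdent[OF O(3)] by simp
  then have "biproduct C (FO X) (FO Y) (FO S) (FA i) (FA j) (FA p) (FA q)"
    unfolding biproduct_def
    using FHom h FComp[OF h(1,3)] FComp[OF h(2,4)] FComp[OF h(2,3)] FComp[OF h(1,4)]
      FComp[OF h(3,1)] FComp[OF h(4,2)] FIdent O additive_endofunctor_ZeroArr e by simp
  then show ?thesis unfolding is_direct_sum_def by blast
qed

lemma additive_endofunctor_isomorphic:
  assumes "isomorphic C X Y"
  shows "isomorphic C (FO X) (FO Y)"
proof -
  obtain f g where h: "f \<in> Hom C X Y" "g \<in> Hom C Y X"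
    and e: "g \<cdot> f = Ident C X" "f \<cdot> g = Ident C Y"
    using assms unfolding isomorphic_def is_iso_def by blast
  have FHom: "\<And>f X Y. f \<in> Hom C X Y \<Longrightarrow> FA f \<in> Hom C (FO X) (FO Y)"
    and FComp: "\<And>f g X Y Z. f \<in> Hom C X Y \<Longrightarrow> g \<in> Hom C Y Z \<Longrightarrow> FA (g \<cdot> f) = FA g \<cdot> FA f"
    and FIdent: "\<And>X. X \<in> Obj C \<Longrightarrow> FA (Ident C X) = Ident C (FO X)"
    using F unfolding additive_endofunctor_def by blast+
  have "FA g \<cdot> FA f = Ident C (FO X)" "FA f \<cdot> FA g = Ident C (FO Y)"
    using FComp[OF h] FComp[OF h(2,1)] FIdent Hom_objects[OF h(1)] e by auto
  then show ?thesis unfolding isomorphic_def is_iso_def using FHom[OF h(1)] FHom[OF h(2)] by blast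
qed

end

section \<open>Closure rules for thick subcategories and their inverse images\<close>

lemma thick_subcategoryD:
  assumes "thick_subcategory C I"
  shows "I \<subseteq> Obj C"
    and "zero_object C Z \<Longrightarrow> Z \<in> I"
    and "is_direct_sum C X Y S \<Longrightarrow> S \<in> I \<longleftrightarrow> X \<in> I \<and> Y \<in> I"
    and "isomorphic C X Y \<Longrightarrow> X \<in> I \<Longrightarrow> Y \<in> I"
    and "X \<in> Obj C \<Longrightarrow> ShiftO C X \<in> I \<longleftrightarrow> X \<in> I"
    and "distinguished C X Y Z f g h \<Longrightarrow> X \<in> I \<Longrightarrow> Y \<in> I \<Longrightarrow> Z \<in> I"
  using assms unfolding thick_subcategory_def triangulated_subcategory_def by blast+

lemma thick_subcategoryI:
  assumes "I \<subseteq> Obj C"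
    and "\<And>Z. zero_object C Z \<Longrightarrow> Z \<in> I"
    and "\<And>X Y S. is_direct_sum C X Y S \<Longrightarrow> S \<in> I \<longleftrightarrow> X \<in> I \<and> Y \<in> I"
    and "\<And>X Y. isomorphic C X Y \<Longrightarrow> X \<in> I \<Longrightarrow> Y \<in> I"
    and "\<And>X. X \<in> Obj C \<Longrightarrow> ShiftO C X \<in> I \<longleftrightarrow> X \<in> I"
    and "\<And>X Y Z f g h. distinguished C X Y Z f g h \<Longrightarrow> X \<in> I \<Longrightarrow> Y \<in> I \<Longrightarrow> Z \<in> I"
  shows "thick_subcategory C I"
  unfolding thick_subcategory_def triangulated_subcategory_def
  using assms by (intro conjI allI ballI impI; blast)

text \<open>Each closure condition is carried into \<open>I\<close> by \<open>FO\<close>. The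
  functor commutes with the shift only up to \<open>\<theta>\<close>, so the shift condition uses
  closure under isomorphism, and the image of a triangle has last arrow
  \<open>\<theta> X \<cdot> FA h\<close>.\<close>

lemma (in triangulated_category) thick_subcategory_inverse_image:
  assumes F: "exact_endofunctor C FO FA" and I: "thick_subcategory C I"
  shows "thick_subcategory C {X \<in> Obj C. FO X \<in> I}"
proof -
  have ad: "additive_endofunctor C FO FA" using F by (simp add: exact_endofunctor_def)
  obtain \<theta> where "\<forall>X \<in> Obj C. is_iso C (FO (ShiftO C X)) (ShiftO C (FO X)) (\<theta> X)"
    and "\<forall>X Y Z f g h. distinguished C X Y Z f g h \<longrightarrow> Dist C (FA f) (FA g) (\<theta> X \<cdot> FA h)"
    using F unfolding exact_endofunctor_def by (elim conjE exE) (rule that; assumption)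
  then have \<theta>: "\<And>X. X \<in> Obj C \<Longrightarrow> is_iso C (FO (ShiftO C X)) (ShiftO C (FO X)) (\<theta> X)"
    and tri: "\<And>X Y Z f g h. distinguished C X Y Z f g h \<Longrightarrow> Dist C (FA f) (FA g) (\<theta> X \<cdot> FA h)"
    by auto
  have FO: "\<And>X. X \<in> Obj C \<Longrightarrow> FO X \<in> Obj C"
    and FHom: "\<And>f X Y. f \<in> Hom C X Y \<Longrightarrow> FA f \<in> Hom C (FO X) (FO Y)"
    using ad unfolding additive_endofunctor_def by blast+
  have Shift_in: "\<And>X. X \<in> Obj C \<Longrightarrow> ShiftO C X \<in> Obj C"
    using Shift_additive unfolding additive_endofunctor_def by blast
  note addax = additive_category_axioms
  note D = thick_subcategoryD[OF I]
  show ?thesis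
  proof (rule thick_subcategoryI)
    fix Z assume "zero_object C Z"
    then show "Z \<in> {X \<in> Obj C. FO X \<in> I}"
      using D(2) additive_endofunctor_zero_object[OF addax ad] by (auto simp: zero_object_def)
  next
    fix X Y S assume "is_direct_sum C X Y S"
    then show "S \<in> {X \<in> Obj C. FO X \<in> I} \<longleftrightarrow> X \<in> {X \<in> Obj C. FO X \<in> I} \<and> Y \<in> {X \<in> Obj C. FO X \<in> I}"
      using D(3)[OF additive_endofunctor_direct_sum[OF addax ad]] direct_sum_objects by simp
  next
    fix X Y assume "isomorphic C X Y" "X \<in> {X \<in> Obj C. FO X \<in> I}"
    then show "Y \<in> {X \<in> Obj C. FO X \<in> I}"
      using D(4)[OF additive_endofunctor_isomorphic[OF addax ad]] isomorphic_objects by simp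
  next
    fix X assume X: "X \<in> Obj C"
    have iso: "isomorphic C (FO (ShiftO C X)) (ShiftO C (FO X))"
      using \<theta>[OF X] unfolding isomorphic_def by blast
    have "FO (ShiftO C X) \<in> I \<longleftrightarrow> FO X \<in> I"
      using D(4)[OF iso] D(4)[OF isomorphic_sym[OF iso]] D(5)[OF FO[OF X]] by blast
    then show "ShiftO C X \<in> {X \<in> Obj C. FO X \<in> I} \<longleftrightarrow> X \<in> {X \<in> Obj C. FO X \<in> I}"
      using X Shift_in by simp
  next
    fix X Y Z f g h
    assume d: "distinguished C X Y Z f g h"
      and X: "X \<in> {X \<in> Obj C. FO X \<in> I}" and Y: "Y \<in> {X \<in> Obj C. FO X \<in> I}"
    have fgh: "f \<in> Hom C X Y" "g \<in> Hom C Y Z" "h \<in> Hom C Z (ShiftO C X)"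
      using d unfolding distinguished_def triangle_def by auto
    have "\<theta> X \<in> Hom C (FO (ShiftO C X)) (ShiftO C (FO X))"
      using \<theta> X unfolding is_iso_def by blast
    then have "distinguished C (FO X) (FO Y) (FO Z) (FA f) (FA g) (\<theta> X \<cdot> FA h)"
      unfolding distinguished_def triangle_def
      using tri[OF d] FHom[OF fgh(1)] FHom[OF fgh(2)] Comp_in[OF FHom[OF fgh(3)]] by blast
    then show "Z \<in> {X \<in> Obj C. FO X \<in> I}"
      using D(6) X Y Hom_objects(2)[OF fgh(2)] by blast
  qed blast
qed

lemma thick_idealD:
  assumes "thick_ideal C I"
  shows "thick_subcategory C I"
    and "X \<in> I \<Longrightarrow> Y \<in> Obj C \<Longrightarrow> X \<odot>\<^bsub>C\<^esub> Y \<in> I"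
    and "X \<in> I \<Longrightarrow> Y \<in> Obj C \<Longrightarrow> Y \<odot>\<^bsub>C\<^esub> X \<in> I"
  using assms unfolding thick_ideal_def by blast+

lemma thick_idealI:
  assumes "thick_subcategory C I"
    and "\<And>X Y. X \<in> I \<Longrightarrow> Y \<in> Obj C \<Longrightarrow> X \<odot>\<^bsub>C\<^esub> Y \<in> I"
    and "\<And>X Y. X \<in> I \<Longrightarrow> Y \<in> Obj C \<Longrightarrow> Y \<odot>\<^bsub>C\<^esub> X \<in> I"
  shows "thick_ideal C I"
  using assms unfolding thick_ideal_def by blast

lemma tensor_set_subset_iff:
  "tensor_set C I J \<subseteq> P \<longleftrightarrow> (\<forall>X \<in> I. \<forall>Y \<in> J. X \<odot>\<^bsub>C\<^esub> Y \<in> P)"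
  by (auto simp: tensor_set_def)

section \<open>Thick ideals and primes\<close>

context triangulated_category
begin

lemma ShiftO_in: "X \<in> Obj C \<Longrightarrow> ShiftO C X \<in> Obj C"
  using Shift_additive unfolding additive_endofunctor_def by blast

lemma thick_subcategory_INT:
  assumes "\<And>i. i \<in> S \<Longrightarrow> thick_subcategory C (T i)"
  shows "thick_subcategory C {X \<in> Obj C. \<forall>i \<in> S. X \<in> T i}"
proof -
  note D = thick_subcategoryD[OF assms]
  show ?thesis
  proof (rule thick_subcategoryI)
    fix X assume "zero_object C X"
    then show "X \<in> {X \<in> Obj C. \<forall>i \<in> S. X \<in> T i}" using D(2) by (auto simp: zero_object_def)
  next
    fix X Y U assume "is_direct_sum C X Y U"
    then show "U \<in> {X \<in> Obj C. \<forall>i \<in> S. X \<in> T i} \<longleftrightarrow>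
        X \<in> {X \<in> Obj C. \<forall>i \<in> S. X \<in> T i} \<and> Y \<in> {X \<in> Obj C. \<forall>i \<in> S. X \<in> T i}"
      using D(3) direct_sum_objects by blast
  next
    fix X Y assume "isomorphic C X Y" "X \<in> {X \<in> Obj C. \<forall>i \<in> S. X \<in> T i}"
    then show "Y \<in> {X \<in> Obj C. \<forall>i \<in> S. X \<in> T i}"
      using D(4) isomorphic_objects by blast
  next
    fix X assume X: "X \<in> Obj C"
    then show "ShiftO C X \<in> {X \<in> Obj C. \<forall>i \<in> S. X \<in> T i} \<longleftrightarrow> X \<in> {X \<in> Obj C. \<forall>i \<in> S. X \<in> T i}"
      using D(5)[OF _ X] ShiftO_in by simp
  next
    fix X Y Z f g h
    assume *: "distinguished C X Y Z f g h" "X \<in> {X \<in> Obj C. \<forall>i \<in> S. X \<in> T i}"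
      "Y \<in> {X \<in> Obj C. \<forall>i \<in> S. X \<in> T i}"
    then have "Z \<in> Obj C"
      unfolding distinguished_def triangle_def using Hom_objects by blast
    then show "Z \<in> {X \<in> Obj C. \<forall>i \<in> S. X \<in> T i}"
      using D(6)[OF _ *(1)] * by blast
  qed blast
qed

text \<open>The witness is a direct sum of \<open>A\<close>: closure under sums gives one direction,
  closure under summands the other. \<open>D\<close> is independent of \<open>I\<close>, so it
  replaces \<open>A\<close> in all thick subcategories at once.\<close>

lemma finite_direct_sum_exists:
  assumes "finite A" "A \<subseteq> Obj C"
  shows "\<exists>D \<in> Obj C. \<forall>I. thick_subcategory C I \<longrightarrow> (D \<in> I \<longleftrightarrow> A \<subseteq> I)"
  using assms
proof (induction rule: finite_induct)
  case empty
  obtain Z where Z: "zero_object C Z" using zero_object_exists by blast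
  then have "Z \<in> Obj C" by (simp add: zero_object_def)
  then show ?case using thick_subcategoryD(2)[OF _ Z] by auto
next
  case (insert X A)
  then obtain D where D: "D \<in> Obj C" "\<And>I. thick_subcategory C I \<Longrightarrow> D \<in> I \<longleftrightarrow> A \<subseteq> I" by auto
  obtain S where S: "is_direct_sum C X D S" using direct_sum_exists[of X D] insert.prems D by auto
  then have "S \<in> Obj C" by (rule direct_sum_objects)
  moreover have "S \<in> I \<longleftrightarrow> Set.insert X A \<subseteq> I" if "thick_subcategory C I" for I
    using thick_subcategoryD(3)[OF that S] D(2)[OF that] by simp
  ultimately show ?case by blast
qed

end

context monoidal_triangulated_category
begin

section \<open>Tensor products in thick subcategories and colon ideals\<close>

lemma thick_tensor_inverse_image:
  assumes "thick_subcategory C P" "Y \<in> Obj C"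
  shows "thick_subcategory C {X \<in> Obj C. X \<odot> Y \<in> P}"
    and "thick_subcategory C {X \<in> Obj C. Y \<odot> X \<in> P}"
  using thick_subcategory_inverse_image[OF Tensor_exact_left[OF assms(2)] assms(1)]
    thick_subcategory_inverse_image[OF Tensor_exact_right[OF assms(2)] assms(1)] .

lemma thick_tensor_assoc:
  assumes "thick_subcategory C P" "X \<in> Obj C" "Y \<in> Obj C" "Z \<in> Obj C"
  shows "X \<odot> Y \<odot> Z \<in> P \<longleftrightarrow> X \<odot> (Y \<odot> Z) \<in> P"
proof -
  have "isomorphic C (X \<odot> Y \<odot> Z) (X \<odot> (Y \<odot> Z))"
    using Assoc_iso[OF assms(2-4)] unfolding isomorphic_def by blast
  with isomorphic_sym[OF this] show ?thesis using thick_subcategoryD(4)[OF assms(1)] by blast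
qed

text \<open>Associativity is applied inside the inverse image of \<open>P\<close> under tensoring
  with \<open>W\<close>, so that no arrow has to be tensored with an identity.\<close>

lemma thick_tensor_assoc_left:
  assumes "thick_subcategory C P" "X \<in> Obj C" "Y \<in> Obj C" "Z \<in> Obj C" "W \<in> Obj C"
  shows "X \<odot> Y \<odot> Z \<odot> W \<in> P \<longleftrightarrow> X \<odot> (Y \<odot> Z) \<odot> W \<in> P"
  using thick_tensor_assoc[OF thick_tensor_inverse_image(1)[OF assms(1,5)] assms(2-4)] assms(2-4)
  by (simp add: TensorO_in)

lemma thick_tensor_unit:
  assumes "thick_subcategory C P" "X \<in> Obj C" "Y \<in> Obj C"
  shows "X \<odot> UnitO C \<odot> Y \<in> P \<longleftrightarrow> X \<odot> Y \<in> P"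
proof -
  have "isomorphic C (X \<odot> UnitO C) X"
    using RUnit_iso[OF assms(2)] unfolding isomorphic_def by blast
  with isomorphic_sym[OF this] thick_subcategoryD(4)[OF thick_tensor_inverse_image(1)[OF assms(1,3)]]
  show ?thesis using assms(2) TensorO_in[OF assms(2) UnitO_in] by blast
qed

text \<open>Every condition is membership in an inverse image of \<open>P\<close> under two tensor
  functors, so thickness is inherited. The middle factor \<open>S\<close> makes the annihilator
  two-sided: a factor on the right of \<open>X\<close> is absorbed by \<open>S\<close>, one on the
  left by the ideal \<open>P\<close>.\<close>

lemma thick_ideal_left_colon:
  assumes P: "thick_ideal C P" and B: "B \<subseteq> Obj C"
  shows "thick_ideal C {X \<in> Obj C. \<forall>S \<in> Obj C. \<forall>b \<in> B. X \<odot> S \<odot> b \<in> P}" (is "thick_ideal C ?L")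
proof (rule thick_idealI)
  note th = thick_idealD(1)[OF P]
  have "thick_subcategory C
      {X \<in> Obj C. \<forall>i \<in> Obj C \<times> B. X \<in> {X \<in> Obj C. X \<odot> fst i \<in> {Y \<in> Obj C. Y \<odot> snd i \<in> P}}}"
    using B by (intro thick_subcategory_INT thick_tensor_inverse_image th) auto
  also have "{X \<in> Obj C. \<forall>i \<in> Obj C \<times> B. X \<in> {X \<in> Obj C. X \<odot> fst i \<in> {Y \<in> Obj C. Y \<odot> snd i \<in> P}}} = ?L"
    using TensorO_in by auto
  finally show "thick_subcategory C ?L" .
  fix X Y assume X: "X \<in> ?L" and Y: "Y \<in> Obj C"
  show "X \<odot> Y \<in> ?L"
    using X Y B thick_tensor_assoc_left[OF th, of X Y] TensorO_in by auto
  have "Y \<odot> X \<odot> S \<odot> b \<in> P" if "S \<in> Obj C" "b \<in> B" for S b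
  proof -
    have b: "b \<in> Obj C" and X': "X \<in> Obj C" using that B X by auto
    have "Y \<odot> (X \<odot> S \<odot> b) \<in> P" using thick_idealD(3)[OF P] X Y that by blast
    then show ?thesis
      using thick_tensor_assoc[OF th Y TensorO_in[OF X' that(1)] b]
        thick_tensor_assoc_left[OF th Y X' that(1) b] by simp
  qed
  then show "Y \<odot> X \<in> ?L" using X Y TensorO_in by auto
qed

lemma thick_ideal_right_colon:
  assumes P: "thick_ideal C P" and A: "A \<subseteq> Obj C"
  shows "thick_ideal C {X \<in> Obj C. \<forall>S \<in> Obj C. \<forall>a \<in> A. a \<odot> S \<odot> X \<in> P}" (is "thick_ideal C ?R")
proof (rule thick_idealI)
  note th = thick_idealD(1)[OF P]
  have "thick_subcategory C
      {X \<in> Obj C. \<forall>i \<in> Obj C \<times> A. X \<in> {X \<in> Obj C. snd i \<odot> fst i \<odot> X \<in> P}}"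
    using A by (intro thick_subcategory_INT thick_tensor_inverse_image th) (auto intro!: TensorO_in)
  also have "{X \<in> Obj C. \<forall>i \<in> Obj C \<times> A. X \<in> {X \<in> Obj C. snd i \<odot> fst i \<odot> X \<in> P}} = ?R"
    by auto
  finally show "thick_subcategory C ?R" .
  fix X Y assume X: "X \<in> ?R" and Y: "Y \<in> Obj C"
  have "a \<odot> S \<odot> (X \<odot> Y) \<in> P" "a \<odot> S \<odot> (Y \<odot> X) \<in> P" if "S \<in> Obj C" "a \<in> A" for S a
  proof -
    have a: "a \<in> Obj C" and X': "X \<in> Obj C" using that A X by auto
    note aS = TensorO_in[OF a that(1)]
    have "a \<odot> S \<odot> X \<odot> Y \<in> P" using thick_idealD(2)[OF P] X Y that by blast
    then show "a \<odot> S \<odot> (X \<odot> Y) \<in> P"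
      using thick_tensor_assoc[OF th aS X' Y] by simp
    have "a \<odot> (S \<odot> Y) \<odot> X \<in> P" using X Y that TensorO_in by blast
    then show "a \<odot> S \<odot> (Y \<odot> X) \<in> P"
      using thick_tensor_assoc[OF th aS Y X'] thick_tensor_assoc_left[OF th a that(1) Y X'] by simp
  qed
  then show "X \<odot> Y \<in> ?R" "Y \<odot> X \<in> ?R" using X Y TensorO_in by auto
qed

text \<open>Passes from products of objects to products of ideals. \<open>I\<close> is the left
  colon of \<open>B\<close>, and \<open>J\<close> is the right colon of \<open>I\<close> rather than
  of \<open>A\<close>, so all \<open>X \<odot> S \<odot> Y\<close> with \<open>X\<close> in
  \<open>I\<close> and \<open>Y\<close> in \<open>J\<close> lie in \<open>P\<close>; the unit as
  \<open>S\<close> gives \<open>X \<odot> Y\<close>.\<close>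

lemma ideals_with_product_in:
  assumes P: "thick_ideal C P" and A: "A \<subseteq> Obj C" and B: "B \<subseteq> Obj C"
    and AB: "\<And>a S b. a \<in> A \<Longrightarrow> S \<in> Obj C \<Longrightarrow> b \<in> B \<Longrightarrow> a \<odot> S \<odot> b \<in> P"
  obtains I J where "thick_ideal C I" "thick_ideal C J" "A \<union> P \<subseteq> I" "B \<union> P \<subseteq> J" "tensor_set C I J \<subseteq> P"
proof -
  note th = thick_idealD(1)[OF P]
  have PO: "P \<subseteq> Obj C" by (rule thick_subcategoryD(1)[OF th])
  define I where "I = {X \<in> Obj C. \<forall>S \<in> Obj C. \<forall>b \<in> B. X \<odot> S \<odot> b \<in> P}"
  define J where "J = {X \<in> Obj C. \<forall>S \<in> Obj C. \<forall>a \<in> I. a \<odot> S \<odot> X \<in> P}"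
  have I: "thick_ideal C I" unfolding I_def by (rule thick_ideal_left_colon[OF P B])
  have J: "thick_ideal C J"
    unfolding J_def by (rule thick_ideal_right_colon[OF P]) (auto simp: I_def)
  have "A \<union> P \<subseteq> I" using A B AB PO thick_idealD(2)[OF P] by (auto simp: I_def)
  moreover have "B \<union> P \<subseteq> J"
    using B PO thick_idealD(3)[OF P] TensorO_in by (auto simp: I_def J_def)
  moreover have "X \<odot> Y \<in> P" if "X \<in> I" "Y \<in> J" for X Y
  proof -
    have "X \<odot> UnitO C \<odot> Y \<in> P" using that UnitO_in by (auto simp: J_def)
    then show ?thesis using thick_tensor_unit[OF th, of X Y] that by (auto simp: I_def J_def)
  qed
  ultimately show ?thesis using that[OF I J] by (simp add: tensor_set_subset_iff)
qed

section \<open>Primes and their existence\<close>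

lemma SpcD:
  assumes "P \<in> Spc C"
  shows "thick_ideal C P" "P \<noteq> Obj C" "thick_subcategory C P"
    and "\<lbrakk>thick_ideal C I; thick_ideal C J; tensor_set C I J \<subseteq> P\<rbrakk> \<Longrightarrow> I \<subseteq> P \<or> J \<subseteq> P"
  using assms thick_idealD(1) unfolding Spc_def prime_ideal_def by blast+

text \<open>Analogue of the criterion \<open>x R y \<subseteq> P\<close> for prime ideals of
  noncommutative rings. The colon construction gives ideals containing \<open>X\<close> and
  \<open>Y\<close> whose product lies in \<open>P\<close>.\<close>

lemma prime_tensor_elements:
  assumes P: "P \<in> Spc C" and X: "X \<in> Obj C" and Y: "Y \<in> Obj C"
    and "\<And>S. S \<in> Obj C \<Longrightarrow> X \<odot> S \<odot> Y \<in> P"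
  shows "X \<in> P \<or> Y \<in> P"
proof -
  obtain I J where "thick_ideal C I" "thick_ideal C J" "{X} \<union> P \<subseteq> I" "{Y} \<union> P \<subseteq> J" "tensor_set C I J \<subseteq> P"
    using ideals_with_product_in[of P "{X}" "{Y}"] SpcD(1)[OF P] X Y assms(4) by auto
  with SpcD(4)[OF P] show ?thesis by blast
qed

lemma UnitO_notin_prime:
  assumes "P \<in> Spc C"
  shows "UnitO C \<notin> P"
proof
  assume u: "UnitO C \<in> P"
  have "X \<in> P" if X: "X \<in> Obj C" for X
  proof -
    have "isomorphic C (UnitO C \<odot> X) X" using LUnit_iso[OF X] unfolding isomorphic_def by blast
    then show ?thesis
      using thick_subcategoryD(4)[OF SpcD(3)[OF assms]] thick_idealD(2)[OF SpcD(1)[OF assms] u X] by blast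
  qed
  then show False using SpcD(2)[OF assms] thick_subcategoryD(1)[OF SpcD(3)[OF assms]] by blast
qed

text \<open>Direct sums and triangles bring two objects together; \<open>dir\<close> puts both into
  one member, where the closure holds. It serves chains, hulls of finite sets and irreducible sets
  of primes.\<close>

lemma thick_ideal_Union:
  assumes ne: "\<T> \<noteq> {}" and th: "\<And>I. I \<in> \<T> \<Longrightarrow> thick_ideal C I"
    and dir: "\<And>X Y. X \<in> \<Union>\<T> \<Longrightarrow> Y \<in> \<Union>\<T> \<Longrightarrow> \<exists>I \<in> \<T>. X \<in> I \<and> Y \<in> I"
  shows "thick_ideal C (\<Union>\<T>)"
proof -
  note D = thick_subcategoryD[OF thick_idealD(1)[OF th]]
  show ?thesis
  proof (rule thick_idealI[OF thick_subcategoryI])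
    show "\<Union>\<T> \<subseteq> Obj C" using D(1) by blast
    show "Z \<in> \<Union>\<T>" if "zero_object C Z" for Z using D(2)[OF _ that] ne by blast
    show "S \<in> \<Union>\<T> \<longleftrightarrow> X \<in> \<Union>\<T> \<and> Y \<in> \<Union>\<T>" if "is_direct_sum C X Y S" for X Y S
      using D(3)[OF _ that] dir[of X Y] by blast
    show "Y \<in> \<Union>\<T>" if "isomorphic C X Y" "X \<in> \<Union>\<T>" for X Y
      using D(4)[OF _ that(1)] that(2) by blast
    show "ShiftO C X \<in> \<Union>\<T> \<longleftrightarrow> X \<in> \<Union>\<T>" if "X \<in> Obj C" for X
      using D(5)[OF _ that] by blast
    show "Z \<in> \<Union>\<T>" if "distinguished C X Y Z f g h" "X \<in> \<Union>\<T>" "Y \<in> \<Union>\<T>" for X Y Z f g h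
      using D(6)[OF _ that(1)] dir[OF that(2,3)] by blast
    show "X \<odot> Y \<in> \<Union>\<T>" "Y \<odot> X \<in> \<Union>\<T>" if "X \<in> \<Union>\<T>" "Y \<in> Obj C" for X Y
      using thick_idealD(2,3)[OF th] that by blast+
  qed
qed

text \<open>The last hypothesis says that \<open>F\<close> is an m-system in the sense of noncommutative ring theory.\<close>

lemma prime_avoiding_exists:
  assumes I: "thick_ideal C I" "I \<inter> F = {}" and F: "F \<noteq> {}" "F \<subseteq> Obj C"
    and m_system: "\<And>I J P. \<lbrakk>thick_ideal C I; thick_ideal C J; thick_ideal C P;
      I \<inter> F \<noteq> {}; J \<inter> F \<noteq> {}; tensor_set C I J \<subseteq> P\<rbrakk> \<Longrightarrow> P \<inter> F \<noteq> {}"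
  obtains P where "P \<in> Spc C" "I \<subseteq> P" "P \<inter> F = {}"
proof -
  define \<A> where "\<A> = {J. thick_ideal C J \<and> I \<subseteq> J \<and> J \<inter> F = {}}"
  have "\<exists>P \<in> \<A>. \<forall>J \<in> \<A>. P \<subseteq> J \<longrightarrow> J = P"
  proof (rule subset_Zorn_nonempty)
    show "\<A> \<noteq> {}" using I by (auto simp: \<A>_def)
    fix \<C> assume \<C>: "\<C> \<noteq> {}" "subset.chain \<A> \<C>"
    have "thick_ideal C (\<Union>\<C>)"
    proof (rule thick_ideal_Union[OF \<C>(1)])
      show "thick_ideal C J" if "J \<in> \<C>" for J
        using that \<C>(2) by (auto simp: subset.chain_def \<A>_def)
      fix X Y assume "X \<in> \<Union>\<C>" "Y \<in> \<Union>\<C>"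
      then obtain J J' where J: "J \<in> \<C>" "X \<in> J" "J' \<in> \<C>" "Y \<in> J'" by blast
      then have "J \<subseteq> J' \<or> J' \<subseteq> J" using \<C>(2) unfolding subset_chain_def by blast
      then show "\<exists>J \<in> \<C>. X \<in> J \<and> Y \<in> J" using J by blast
    qed
    then show "\<Union>\<C> \<in> \<A>" using \<C> by (auto simp: \<A>_def subset.chain_def)
  qed
  then obtain P where P: "thick_ideal C P" "I \<subseteq> P" "P \<inter> F = {}"
    and max: "\<And>J. thick_ideal C J \<Longrightarrow> P \<subseteq> J \<Longrightarrow> J \<inter> F = {} \<Longrightarrow> J = P"
    unfolding \<A>_def by auto
  have "prime_ideal C P"
    unfolding prime_ideal_def
  proof (intro conjI allI impI)
    show "P \<noteq> Obj C" using F P(3) by blast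
    fix J J' assume J: "thick_ideal C J \<and> thick_ideal C J' \<and> tensor_set C J J' \<subseteq> P"
    have JO: "J \<subseteq> Obj C" "J' \<subseteq> Obj C" using J thick_idealD(1) thick_subcategoryD(1) by blast+
    \<comment> \<open>\<open>J\<close> and \<open>J'\<close> need not contain \<open>P\<close>, so
      maximality does not apply to them. They are enlarged to ideals over \<open>P\<close> with
      product still in \<open>P\<close>; by \<open>m_system\<close> one of these avoids
      \<open>F\<close> and hence equals \<open>P\<close>.\<close>
    have "X \<odot> S \<odot> Y \<in> P" if "X \<in> J" "S \<in> Obj C" "Y \<in> J'" for X S Y
      using J that thick_idealD(2)[of C J X S] by (auto simp: tensor_set_subset_iff)
    then obtain L L' where L: "thick_ideal C L" "thick_ideal C L'" "J \<union> P \<subseteq> L" "J' \<union> P \<subseteq> L'"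
      "tensor_set C L L' \<subseteq> P"
      using ideals_with_product_in[OF P(1) JO] by metis
    then have "L \<inter> F = {} \<or> L' \<inter> F = {}" using m_system[OF L(1,2) P(1)] P(3) by blast
    then show "J \<subseteq> P \<or> J' \<subseteq> P" using L max[of L] max[of L'] by blast
  qed (rule P(1))
  then show ?thesis using that P by (simp add: Spc_def)
qed

end

section \<open>Semiprime hulls and compactness\<close>

text \<open>Hulls of unions are the joins in \<open>T_s C\<close>. Intersecting with
  \<open>Obj C\<close> gives the right value when no prime contains \<open>A\<close>.\<close>

definition semiprime_hull :: "('o, 'm, 'e) mt_category_scheme \<Rightarrow> 'o set \<Rightarrow> 'o set" where
  "semiprime_hull C A = Obj C \<inter> \<Inter>{P \<in> Spc C. A \<subseteq> P}"

definition hull_finitary :: "('o, 'm, 'e) mt_category_scheme \<Rightarrow> bool" where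
  "hull_finitary C \<longleftrightarrow> (\<forall>A \<subseteq> Obj C. \<forall>X \<in> semiprime_hull C A.
     \<exists>A' \<subseteq> A. finite A' \<and> X \<in> semiprime_hull C A')"

lemma semiprime_hull_iff:
  "X \<in> semiprime_hull C A \<longleftrightarrow> X \<in> Obj C \<and> (\<forall>P \<in> Spc C. A \<subseteq> P \<longrightarrow> X \<in> P)"
  by (auto simp: semiprime_hull_def)

lemma semiprime_hull_mono: "A \<subseteq> B \<Longrightarrow> semiprime_hull C A \<subseteq> semiprime_hull C B"
  by (auto simp: semiprime_hull_iff)

lemma semiprime_hull_semiprime: "I \<in> semiprimes C \<Longrightarrow> semiprime_hull C I = I"
  unfolding semiprimes_def semiprime_ideal_def semiprime_hull_def by blast

section \<open>Bounds in posets of sets ordered by inclusion\<close>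

lemma inclusion_order_simps [simp]:
  "carrier (inclusion_order A) = A"
  "I \<sqsubseteq>\<^bsub>inclusion_order A\<^esub> J \<longleftrightarrow> I \<subseteq> J"
  "I .=\<^bsub>inclusion_order A\<^esub> J \<longleftrightarrow> I = J"
  by (simp_all add: inclusion_order_def)

text \<open>The supremum is picked by \<open>SOME\<close> among the least upper bounds, so
  uniqueness identifies it with \<open>I\<close>.\<close>

lemma sup_inclusion_order:
  assumes "least (inclusion_order A) I (Upper (inclusion_order A) S)"
  shows "\<Squnion>\<^bsub>inclusion_order A\<^esub>S = I"
  unfolding Lattice.sup_def
  by (rule some_equality, rule assms)
    (rule partial_order.least_unique[OF partial_order_inclusion_order _ assms])

lemma inf_inclusion_order:
  assumes "greatest (inclusion_order A) I (Lower (inclusion_order A) S)"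
  shows "\<Sqinter>\<^bsub>inclusion_order A\<^esub>S = I"
  unfolding Lattice.inf_def
  by (rule some_equality, rule assms)
    (rule partial_order.greatest_unique[OF partial_order_inclusion_order _ assms])

lemma least_Upper_inclusion_orderI:
  assumes "I \<in> A" "S \<subseteq> A" "\<Union>S \<subseteq> I" "\<And>J. J \<in> A \<Longrightarrow> \<Union>S \<subseteq> J \<Longrightarrow> I \<subseteq> J"
  shows "least (inclusion_order A) I (Upper (inclusion_order A) S)"
proof -
  have "Upper (inclusion_order A) S = {J \<in> A. \<Union>S \<subseteq> J}" using assms(2) by (auto simp: Upper_def)
  then show ?thesis using assms by (simp add: least_def)
qed

lemma greatest_Lower_inclusion_orderI:
  assumes "I \<in> A" "S \<subseteq> A" "I \<subseteq> \<Inter>S" "\<And>J. J \<in> A \<Longrightarrow> J \<subseteq> \<Inter>S \<Longrightarrow> J \<subseteq> I"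
  shows "greatest (inclusion_order A) I (Lower (inclusion_order A) S)"
proof -
  have "Lower (inclusion_order A) S = {J \<in> A. J \<subseteq> \<Inter>S}" using assms(2) by (auto simp: Lower_def)
  then show ?thesis using assms by (simp add: greatest_def)
qed

context monoidal_triangulated_category
begin

section \<open>Hulls, and the two conditions of (a) in terms of primes\<close>

lemma semiprime_hull_in: "semiprime_hull C A \<in> semiprimes C"
proof -
  have "thick_ideal C (semiprime_hull C A)"
    unfolding semiprime_hull_def by (rule thick_ideal_Inter) (auto dest: SpcD(1))
  then show ?thesis
    unfolding semiprimes_def semiprime_ideal_def semiprime_hull_def by blast
qed

lemma subset_semiprime_hull: "A \<subseteq> Obj C \<Longrightarrow> A \<subseteq> semiprime_hull C A"
  by (auto simp: semiprime_hull_iff)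

lemma semiprime_hull_least:
  assumes "I \<in> semiprimes C" "A \<subseteq> I"
  shows "semiprime_hull C A \<subseteq> I"
  using semiprime_hull_mono[OF assms(2), of C] semiprime_hull_semiprime[OF assms(1)] by simp

lemma prime_semiprime: "P \<in> Spc C \<Longrightarrow> P \<in> semiprimes C"
  using thick_subcategoryD(1)[OF SpcD(3)] SpcD(1)
  unfolding semiprimes_def semiprime_ideal_def by blast

lemma semiprime_gen_eq_hull: "X \<in> Obj C \<Longrightarrow> semiprime_gen C X = semiprime_hull C {X}"
  using semiprime_hull_in[of "{X}"] semiprime_hull_least[of _ "{X}"] subset_semiprime_hull[of "{X}"]
  unfolding semiprime_gen_def by blast

lemma principal_semiprimes_eq: "principal_semiprimes C = (\<lambda>X. semiprime_hull C {X}) ` Obj C"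
  using semiprime_gen_eq_hull unfolding principal_semiprimes_def by auto

lemma semiprime_hull_finite_set:
  assumes "finite A" "A \<subseteq> Obj C"
  obtains D where "D \<in> Obj C" "semiprime_hull C A = semiprime_hull C {D}"
proof -
  obtain D where D: "D \<in> Obj C" "\<forall>I. thick_subcategory C I \<longrightarrow> (D \<in> I \<longleftrightarrow> A \<subseteq> I)"
    using finite_direct_sum_exists[OF assms] by blast
  then have "semiprime_hull C A = semiprime_hull C {D}"
    using SpcD(3) by (auto simp: semiprime_hull_iff)
  with D(1) that show ?thesis by blast
qed

text \<open>Both ideals absorb tensor factors, so their product lies in \<open>I \<inter> J\<close>
  and primeness applies.\<close>

lemma prime_Int:
  assumes "P \<in> Spc C" "I \<in> semiprimes C" "J \<in> semiprimes C" "I \<inter> J \<subseteq> P"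
  shows "I \<subseteq> P \<or> J \<subseteq> P"
proof (rule SpcD(4)[OF assms(1)])
  show I: "thick_ideal C I" and J: "thick_ideal C J"
    using assms by (auto simp: semiprimes_def semiprime_ideal_def)
  have "X \<odot> Y \<in> I \<inter> J" if "X \<in> I" "Y \<in> J" for X Y
    using thick_idealD(2)[OF I that(1)] thick_idealD(3)[OF J that(2)] that
      semiprime_subset assms(2,3) by blast
  then show "tensor_set C I J \<subseteq> P" using assms(4) by (auto simp: tensor_set_subset_iff)
qed

text \<open>A prime contains \<open>semiprime_hull C {X}\<close> exactly if it contains
  \<open>X\<close>, so \<open>prime_Int\<close> turns the equality of ideals into
  \<open>D(Z) = D(X) \<union> D(Y)\<close>.\<close>

lemma semiprime_hull_Int_eq_iff:
  assumes "X \<in> Obj C" "Y \<in> Obj C" "Z \<in> Obj C"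
  shows "semiprime_hull C {X} \<inter> semiprime_hull C {Y} = semiprime_hull C {Z} \<longleftrightarrow>
    (\<forall>P \<in> Spc C. Z \<in> P \<longleftrightarrow> X \<in> P \<or> Y \<in> P)"
proof
  assume eq: "semiprime_hull C {X} \<inter> semiprime_hull C {Y} = semiprime_hull C {Z}"
  show "\<forall>P \<in> Spc C. Z \<in> P \<longleftrightarrow> X \<in> P \<or> Y \<in> P"
  proof
    fix P assume P: "P \<in> Spc C"
    have sub: "W \<in> P \<longleftrightarrow> semiprime_hull C {W} \<subseteq> P" if "W \<in> Obj C" for W
      using semiprime_hull_least[OF prime_semiprime[OF P], of "{W}"] subset_semiprime_hull[of "{W}"] that
      by blast
    show "Z \<in> P \<longleftrightarrow> X \<in> P \<or> Y \<in> P"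
      using prime_Int[OF P semiprime_hull_in semiprime_hull_in, of "{X}" "{Y}"] eq sub assms by blast
  qed
next
  assume *: "\<forall>P \<in> Spc C. Z \<in> P \<longleftrightarrow> X \<in> P \<or> Y \<in> P"
  show "semiprime_hull C {X} \<inter> semiprime_hull C {Y} = semiprime_hull C {Z}"
  proof (intro subset_antisym subsetI)
    fix W assume W: "W \<in> semiprime_hull C {X} \<inter> semiprime_hull C {Y}"
    have "W \<in> P" if P: "P \<in> Spc C" and "Z \<in> P" for P
    proof -
      have "X \<in> P \<or> Y \<in> P" using bspec[OF * P] that(2) by simp
      with W P show ?thesis unfolding semiprime_hull_iff Int_iff by auto
    qed
    then show "W \<in> semiprime_hull C {Z}" using W by (auto simp: semiprime_hull_iff)
  next
    fix W assume W: "W \<in> semiprime_hull C {Z}"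
    have "W \<in> P" if P: "P \<in> Spc C" and "X \<in> P \<or> Y \<in> P" for P
    proof -
      have "Z \<in> P" using bspec[OF * P] that(2) by simp
      with W P show ?thesis unfolding semiprime_hull_iff by simp
    qed
    then show "W \<in> semiprime_hull C {X} \<inter> semiprime_hull C {Y}"
      using W by (auto simp: semiprime_hull_iff)
  qed
qed

lemma principal_closure_iff:
  "principal_closure C \<longleftrightarrow>
     (\<forall>X \<in> Obj C. \<forall>Y \<in> Obj C. \<exists>Z \<in> Obj C. \<forall>P \<in> Spc C. Z \<in> P \<longleftrightarrow> X \<in> P \<or> Y \<in> P)"
  unfolding principal_closure_def
  by (simp add: semiprime_gen_eq_hull semiprime_hull_Int_eq_iff cong: ball_cong bex_cong)

text \<open>Primes suffice because a semiprime ideal is an intersection of primes; the step from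
  \<open>X\<close> to \<open>X \<odot> S \<odot> X\<close> holds in every thick ideal.\<close>

lemma compact_detection_iff:
  "compact_detection C \<longleftrightarrow>
     (\<forall>X \<in> Obj C. \<exists>S \<in> Obj C. \<forall>P \<in> Spc C. X \<odot> S \<odot> X \<in> P \<longrightarrow> X \<in> P)"
proof -
  have "(\<forall>I. semiprime_ideal C I \<longrightarrow> (X \<in> I \<longleftrightarrow> X \<odot> S \<odot> X \<in> I)) \<longleftrightarrow>
      (\<forall>P \<in> Spc C. X \<odot> S \<odot> X \<in> P \<longrightarrow> X \<in> P)" if X: "X \<in> Obj C" and S: "S \<in> Obj C" for X S
  proof
    assume "\<forall>I. semiprime_ideal C I \<longrightarrow> (X \<in> I \<longleftrightarrow> X \<odot> S \<odot> X \<in> I)"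
    then show "\<forall>P \<in> Spc C. X \<odot> S \<odot> X \<in> P \<longrightarrow> X \<in> P"
      using prime_semiprime by (auto simp: semiprimes_def)
  next
    assume *: "\<forall>P \<in> Spc C. X \<odot> S \<odot> X \<in> P \<longrightarrow> X \<in> P"
    show "\<forall>I. semiprime_ideal C I \<longrightarrow> (X \<in> I \<longleftrightarrow> X \<odot> S \<odot> X \<in> I)"
    proof (intro allI impI)
      fix I assume I: "semiprime_ideal C I"
      then obtain \<S> where "\<S> \<subseteq> Spc C" "I = Obj C \<inter> \<Inter>\<S>" by (auto simp: semiprime_ideal_def)
      then have "X \<odot> S \<odot> X \<in> I \<Longrightarrow> X \<in> I" using * X by auto
      moreover have "thick_ideal C I" using I by (simp add: semiprime_ideal_def)
      then have "X \<in> I \<Longrightarrow> X \<odot> S \<odot> X \<in> I" using X S thick_idealD(2) by meson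
      ultimately show "X \<in> I \<longleftrightarrow> X \<odot> S \<odot> X \<in> I" by blast
    qed
  qed
  then show ?thesis unfolding compact_detection_def by (simp cong: ball_cong bex_cong)
qed

section \<open>Compact detection and finitarity of the hull\<close>

lemma compact_detection_imp_finitary:
  assumes "compact_detection C"
  shows "hull_finitary C"
  unfolding hull_finitary_def
proof (intro allI impI ballI)
  fix A X assume A: "A \<subseteq> Obj C" and X: "X \<in> semiprime_hull C A"
  obtain s where s: "\<And>Y. Y \<in> Obj C \<Longrightarrow> s Y \<in> Obj C"
    and s_iff: "\<And>Y I. Y \<in> Obj C \<Longrightarrow> I \<in> semiprimes C \<Longrightarrow> Y \<odot> s Y \<odot> Y \<in> I \<Longrightarrow> Y \<in> I"
    using assms unfolding compact_detection_def semiprimes_def by (metis mem_Collect_eq)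
  define f where "f n = ((\<lambda>Y. Y \<odot> s Y \<odot> Y) ^^ n) X" for n
  have f0: "f 0 = X" and fSuc: "\<And>n. f (Suc n) = f n \<odot> s (f n) \<odot> f n" by (simp_all add: f_def)
  have fO: "f n \<in> Obj C" for n
  proof (induction n)
    case 0 then show ?case using X f0 by (simp add: semiprime_hull_iff)
  qed (simp add: fSuc TensorO_in s)
  \<comment> \<open>The hulls of the finite subsets of \<open>A\<close> form a directed family; its
    union is an ideal containing \<open>A\<close>, from which the prime is built.\<close>
  define \<T> where "\<T> = semiprime_hull C ` {A'. A' \<subseteq> A \<and> finite A'}"
  show "\<exists>A' \<subseteq> A. finite A' \<and> X \<in> semiprime_hull C A'"
  proof (rule ccontr)
    assume no: "\<not> ?thesis"
    \<comment> \<open>Detection is used contrapositively: a semiprime ideal without one term of the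
      sequence does not contain the next.\<close>
    have notin: "f n \<notin> I" if "I \<in> \<T>" for n I
    proof (induction n)
      case 0 then show ?case using no that f0 by (auto simp: \<T>_def)
    next
      case (Suc n)
      have "I \<in> semiprimes C" using that semiprime_hull_in by (auto simp: \<T>_def)
      then show ?case using s_iff[OF fO] Suc fSuc by auto
    qed
    have thick: "thick_ideal C (\<Union>\<T>)"
    proof (rule thick_ideal_Union)
      show "\<T> \<noteq> {}" by (auto simp: \<T>_def)
      show "thick_ideal C I" if "I \<in> \<T>" for I
        using that semiprime_hull_in by (auto simp: \<T>_def semiprimes_def semiprime_ideal_def)
      fix Y Z assume "Y \<in> \<Union>\<T>" "Z \<in> \<Union>\<T>"
      then obtain B B' where "B \<subseteq> A" "finite B" "B' \<subseteq> A" "finite B'"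
        "Y \<in> semiprime_hull C B" "Z \<in> semiprime_hull C B'" by (auto simp: \<T>_def)
      then have "B \<union> B' \<subseteq> A \<and> finite (B \<union> B')" "Y \<in> semiprime_hull C (B \<union> B')"
        "Z \<in> semiprime_hull C (B \<union> B')"
        using semiprime_hull_mono[of B "B \<union> B'"] semiprime_hull_mono[of B' "B \<union> B'"] by blast+
      then show "\<exists>I \<in> \<T>. Y \<in> I \<and> Z \<in> I" unfolding \<T>_def by blast
    qed
    \<comment> \<open>An ideal with one term has all later ones. So two ideals with terms of index
      \<open>m\<close> and \<open>n\<close> share the term of index \<open>m + n\<close>, and the
      next term lies in their product.\<close>
    have up: "f (m + k) \<in> I" if I: "thick_ideal C I" "f m \<in> I" for m k I
    proof (induction k)
      case (Suc k)
      then show ?case using fSuc thick_idealD(3)[OF I(1)] fO s TensorO_in by simp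
    qed (use I in simp)
    obtain P where P: "P \<in> Spc C" "\<Union>\<T> \<subseteq> P" "P \<inter> range f = {}"
    proof (rule prime_avoiding_exists[OF thick, of "range f"])
      show "\<Union>\<T> \<inter> range f = {}" using notin by blast
      show "range f \<subseteq> Obj C" using fO by blast
      fix I J P
      assume I: "thick_ideal C I" and J: "thick_ideal C J" and "I \<inter> range f \<noteq> {}" "J \<inter> range f \<noteq> {}"
        and IJ: "tensor_set C I J \<subseteq> P"
      then obtain m n where "f m \<in> I" "f n \<in> J" by blast
      then have "f (m + n) \<in> I" "f (m + n) \<in> J" using up[OF I, of m n] up[OF J, of n m] by (simp_all add: add.commute)
      then have "f (Suc (m + n)) \<in> P"
        using IJ thick_idealD(2)[OF I _ s[OF fO]] by (simp add: fSuc tensor_set_subset_iff)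
      then show "P \<inter> range f \<noteq> {}" by blast
    qed auto
    have "A \<subseteq> P"
    proof
      fix Y assume "Y \<in> A"
      then have "semiprime_hull C {Y} \<in> \<T>" "Y \<in> semiprime_hull C {Y}"
        using A subset_semiprime_hull[of "{Y}"] by (auto simp: \<T>_def)
      then show "Y \<in> P" using P(2) by blast
    qed
    then have "f 0 \<in> P" using X P(1) f0 by (auto simp: semiprime_hull_iff)
    then show False using P(3) by blast
  qed
qed

text \<open>Primeness puts \<open>Z\<close> into the hull of all
  \<open>X \<odot> S \<odot> Y\<close>; finitarity leaves finitely many \<open>S\<close>, and their
  direct sum replaces them. The case \<open>X = Y = Z\<close> is compact detection; a
  \<open>Z\<close> with \<open>D(Z) = D(X) \<union> D(Y)\<close> gives detection for pairs.\<close>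

lemma finitary_imp_tensor:
  assumes fin: "hull_finitary C" and X: "X \<in> Obj C" and Y: "Y \<in> Obj C" and Z: "Z \<in> Obj C"
    and sub: "\<And>P. P \<in> Spc C \<Longrightarrow> X \<in> P \<or> Y \<in> P \<Longrightarrow> Z \<in> P"
  shows "\<exists>S \<in> Obj C. \<forall>P \<in> Spc C. X \<odot> S \<odot> Y \<in> P \<longrightarrow> Z \<in> P"
proof -
  define t where "t S = X \<odot> S \<odot> Y" for S
  have "Z \<in> semiprime_hull C (t ` Obj C)"
    using prime_tensor_elements[OF _ X Y] Z sub by (auto simp: semiprime_hull_iff t_def image_subset_iff)
  moreover have "t ` Obj C \<subseteq> Obj C" using X Y TensorO_in by (auto simp: t_def)
  ultimately obtain A where A: "A \<subseteq> t ` Obj C" "finite A" "Z \<in> semiprime_hull C A"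
    using fin unfolding hull_finitary_def by meson
  then obtain B where B: "B \<subseteq> Obj C" "finite B" "A = t ` B" by (meson finite_subset_image)
  obtain S where S: "S \<in> Obj C" "\<forall>I. thick_subcategory C I \<longrightarrow> (S \<in> I \<longleftrightarrow> B \<subseteq> I)"
    using finite_direct_sum_exists[OF B(2,1)] by blast
  have "Z \<in> P" if P: "P \<in> Spc C" and XSY: "X \<odot> S \<odot> Y \<in> P" for P
  proof -
    \<comment> \<open>The objects that may stand between \<open>X\<close> and \<open>Y\<close> form
      a thick subcategory, so membership of the direct sum \<open>S\<close> passes to its summands
      \<open>B\<close>.\<close>
    have "thick_subcategory C {S \<in> Obj C. X \<odot> S \<in> {W \<in> Obj C. W \<odot> Y \<in> P}}"
      using thick_tensor_inverse_image(2)[OF thick_tensor_inverse_image(1)[OF SpcD(3)[OF P] Y] X] .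
    then have "B \<subseteq> {S \<in> Obj C. X \<odot> S \<in> {W \<in> Obj C. W \<odot> Y \<in> P}}"
      using S XSY TensorO_in[OF X S(1)] by blast
    then have "A \<subseteq> P" by (auto simp: B(3) t_def)
    then show ?thesis using A(3) P by (auto simp: semiprime_hull_iff)
  qed
  with S(1) show ?thesis by (intro bexI[of _ S] ballI impI)
qed

lemma finitary_imp_compact_detection:
  assumes "hull_finitary C"
  shows "compact_detection C"
  unfolding compact_detection_iff
proof
  fix X assume X: "X \<in> Obj C"
  show "\<exists>S \<in> Obj C. \<forall>P \<in> Spc C. X \<odot> S \<odot> X \<in> P \<longrightarrow> X \<in> P"
    by (rule finitary_imp_tensor[OF assms X X X]) simp
qed

section \<open>Compact elements and the lattice of principal semiprime ideals\<close>

lemma Sup_T_s: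
  assumes "S \<subseteq> semiprimes C"
  shows "\<Squnion>\<^bsub>T_s C\<^esub>S = semiprime_hull C (\<Union>S)"
proof -
  have "\<Union>S \<subseteq> Obj C" using assms semiprime_subset by blast
  then show ?thesis
    unfolding T_s_def
    by (intro sup_inclusion_order least_Upper_inclusion_orderI assms semiprime_hull_in
        subset_semiprime_hull semiprime_hull_least)
qed

lemma compact_elements_T_s_iff:
  "I \<in> compact_elements (T_s C) \<longleftrightarrow> I \<in> semiprimes C \<and>
     (\<forall>S \<subseteq> semiprimes C. I \<subseteq> semiprime_hull C (\<Union>S) \<longrightarrow>
        (\<exists>S' \<subseteq> S. finite S' \<and> I \<subseteq> semiprime_hull C (\<Union>S')))"
proof -
  have "(\<exists>S' \<subseteq> S. finite S' \<and> I \<subseteq> \<Squnion>\<^bsub>T_s C\<^esub>S') \<longleftrightarrow>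
      (\<exists>S' \<subseteq> S. finite S' \<and> I \<subseteq> semiprime_hull C (\<Union>S'))" if "S \<subseteq> semiprimes C" for S
    using Sup_T_s that by (metis order_trans)
  moreover have "carrier (T_s C) = semiprimes C" "\<And>I J. I \<sqsubseteq>\<^bsub>T_s C\<^esub> J \<longleftrightarrow> I \<subseteq> J"
    by (simp_all add: T_s_def)
  ultimately show ?thesis
    unfolding compact_elements_def by (auto simp: Sup_T_s)
qed

text \<open>Translates between families of objects and families of principal semiprime ideals when
  joins are formed.\<close>

lemma semiprime_hull_UN_hull:
  assumes "A \<subseteq> Obj C"
  shows "semiprime_hull C (\<Union>X \<in> A. semiprime_hull C {X}) = semiprime_hull C A"
proof (rule subset_antisym)
  show "semiprime_hull C (\<Union>X \<in> A. semiprime_hull C {X}) \<subseteq> semiprime_hull C A"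
  proof (rule semiprime_hull_least[OF semiprime_hull_in], rule UN_least)
    fix X assume "X \<in> A"
    then show "semiprime_hull C {X} \<subseteq> semiprime_hull C A" by (intro semiprime_hull_mono) simp
  qed
  show "semiprime_hull C A \<subseteq> semiprime_hull C (\<Union>X \<in> A. semiprime_hull C {X})"
    using subset_semiprime_hull[of "{_}"] assms by (intro semiprime_hull_mono) blast
qed

text \<open>A semiprime ideal is the join of the principal ideals of its objects. Compactness leaves
  finitely many objects, and their direct sum generates the ideal.\<close>

lemma compact_elements_principal: "compact_elements (T_s C) \<subseteq> principal_semiprimes C"
proof
  fix I assume I: "I \<in> compact_elements (T_s C)"
  then have s: "I \<in> semiprimes C" by (simp add: compact_elements_T_s_iff)
  have IO: "I \<subseteq> Obj C" using semiprime_subset[OF s] .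
  define S where "S = (\<lambda>X. semiprime_hull C {X}) ` I"
  have "S \<subseteq> semiprimes C" using semiprime_hull_in by (auto simp: S_def)
  moreover have "I \<subseteq> semiprime_hull C (\<Union>S)"
    using semiprime_hull_UN_hull[OF IO] semiprime_hull_semiprime[OF s] by (simp add: S_def)
  ultimately obtain S' where "S' \<subseteq> S" "finite S'" "I \<subseteq> semiprime_hull C (\<Union>S')"
    using I unfolding compact_elements_T_s_iff by meson
  moreover from this obtain A where A: "A \<subseteq> I" "finite A" "S' = (\<lambda>X. semiprime_hull C {X}) ` A"
    unfolding S_def by (meson finite_subset_image)
  ultimately have "I \<subseteq> semiprime_hull C A" using semiprime_hull_UN_hull[of A] IO by simp
  then have "I = semiprime_hull C A" using semiprime_hull_least[OF s A(1)] by simp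
  moreover obtain D where "D \<in> Obj C" "semiprime_hull C A = semiprime_hull C {D}"
    using semiprime_hull_finite_set[OF A(2) order_trans[OF A(1) IO]] .
  ultimately show "I \<in> principal_semiprimes C"
    unfolding principal_semiprimes_eq by simp
qed

text \<open>Compact elements are always principal, so the equality asks that principal ideals be
  compact. Through \<open>semiprime_hull_UN_hull\<close> this is the choice of finitely many
  generators.\<close>

lemma finitary_iff_compact_elements:
  "hull_finitary C \<longleftrightarrow> principal_semiprimes C = compact_elements (T_s C)"
proof
  assume fin: "hull_finitary C"
  have "semiprime_hull C {X} \<in> compact_elements (T_s C)" if X: "X \<in> Obj C" for X
    unfolding compact_elements_T_s_iff
  proof (intro conjI allI impI semiprime_hull_in)
    fix S assume S: "S \<subseteq> semiprimes C" and sub: "semiprime_hull C {X} \<subseteq> semiprime_hull C (\<Union>S)"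
    have "\<Union>S \<subseteq> Obj C" "X \<in> semiprime_hull C (\<Union>S)"
      using S semiprime_subset sub subset_semiprime_hull[of "{X}"] X by blast+
    then obtain A where A: "A \<subseteq> \<Union>S" "finite A" "X \<in> semiprime_hull C A"
      using fin unfolding hull_finitary_def by meson
    obtain S' where S': "finite S'" "S' \<subseteq> S" "A \<subseteq> \<Union>S'"
      using finite_subset_Union[OF A(2,1)] by metis
    then have "X \<in> semiprime_hull C (\<Union>S')" using semiprime_hull_mono A(3) by blast
    then have "semiprime_hull C {X} \<subseteq> semiprime_hull C (\<Union>S')"
      by (intro semiprime_hull_least semiprime_hull_in) simp
    with S' show "\<exists>S' \<subseteq> S. finite S' \<and> semiprime_hull C {X} \<subseteq> semiprime_hull C (\<Union>S')" by blast
  qed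
  then show "principal_semiprimes C = compact_elements (T_s C)"
    using compact_elements_principal unfolding principal_semiprimes_eq by blast
next
  assume eq: "principal_semiprimes C = compact_elements (T_s C)"
  show "hull_finitary C"
    unfolding hull_finitary_def
  proof (intro allI impI ballI)
    fix A X assume A: "A \<subseteq> Obj C" and X: "X \<in> semiprime_hull C A"
    then have XO: "X \<in> Obj C" by (simp add: semiprime_hull_iff)
    define S where "S = (\<lambda>X. semiprime_hull C {X}) ` A"
    have "semiprime_hull C {X} \<in> compact_elements (T_s C)"
      using eq XO unfolding principal_semiprimes_eq by blast
    moreover have "S \<subseteq> semiprimes C" using semiprime_hull_in by (auto simp: S_def)
    moreover have "semiprime_hull C {X} \<subseteq> semiprime_hull C (\<Union>S)"
      using X by (intro semiprime_hull_least semiprime_hull_in) (simp add: S_def semiprime_hull_UN_hull[OF A])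
    ultimately obtain S' where S': "S' \<subseteq> S" "finite S'" "semiprime_hull C {X} \<subseteq> semiprime_hull C (\<Union>S')"
      unfolding compact_elements_T_s_iff by meson
    then obtain A' where A': "A' \<subseteq> A" "finite A'" "S' = (\<lambda>X. semiprime_hull C {X}) ` A'"
      unfolding S_def by (meson finite_subset_image)
    then have "X \<in> semiprime_hull C A'"
      using S'(3) semiprime_hull_UN_hull[of A'] A subset_semiprime_hull[of "{X}"] XO by auto
    with A' show "\<exists>A' \<subseteq> A. finite A' \<and> X \<in> semiprime_hull C A'" by blast
  qed
qed

text \<open>Meets are intersections, principal by hypothesis; the join of two principal ideals is
  generated by a direct sum of the generators. Distributivity is checked on primes.\<close>

lemma principal_closure_imp_lattice:
  assumes pc: "principal_closure C"
  shows "bounded_distributive_lattice (t_s C)"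
proof -
  let ?T = "principal_semiprimes C"
  have sp: "I \<in> semiprimes C" if "I \<in> ?T" for I
    using that semiprime_hull_in by (auto simp: principal_semiprimes_eq)
  have Int: "I \<inter> J \<in> ?T" if IJ: "I \<in> ?T" "J \<in> ?T" for I J
  proof -
    obtain X Y where XY: "X \<in> Obj C" "Y \<in> Obj C" "I = semiprime_gen C X" "J = semiprime_gen C Y"
      using IJ by (auto simp: principal_semiprimes_def)
    then obtain Z where "Z \<in> Obj C" "I \<inter> J = semiprime_gen C Z"
      using pc unfolding principal_closure_def by meson
    then show ?thesis by (auto simp: principal_semiprimes_def)
  qed
  have Join: "semiprime_hull C (I \<union> J) \<in> ?T" if IJ: "I \<in> ?T" "J \<in> ?T" for I J
  proof -
    obtain X Y where XY: "X \<in> Obj C" "Y \<in> Obj C" "I = semiprime_hull C {X}" "J = semiprime_hull C {Y}"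
      using IJ by (auto simp: principal_semiprimes_eq)
    then have "semiprime_hull C (I \<union> J) = semiprime_hull C {X, Y}"
      using semiprime_hull_UN_hull[of "{X, Y}"] by simp
    moreover obtain D where "D \<in> Obj C" "semiprime_hull C {X, Y} = semiprime_hull C {D}"
      using semiprime_hull_finite_set[of "{X, Y}"] XY by auto
    ultimately show ?thesis by (auto simp: principal_semiprimes_eq)
  qed
  have inf: "greatest (t_s C) (I \<inter> J) (Lower (t_s C) {I, J})" if "I \<in> ?T" "J \<in> ?T" for I J
    unfolding t_s_def using that Int by (intro greatest_Lower_inclusion_orderI) auto
  have sup: "least (t_s C) (semiprime_hull C (I \<union> J)) (Upper (t_s C) {I, J})" if "I \<in> ?T" "J \<in> ?T" for I J
    unfolding t_s_def
  proof (rule least_Upper_inclusion_orderI)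
    show "\<Union>{I, J} \<subseteq> semiprime_hull C (I \<union> J)"
      using subset_semiprime_hull[of "I \<union> J"] semiprime_subset sp that by simp
  qed (use that Join sp semiprime_hull_least in auto)
  have meet: "I \<sqinter>\<^bsub>t_s C\<^esub> J = I \<inter> J" if "I \<in> ?T" "J \<in> ?T" for I J
    using inf[OF that] unfolding meet_def t_s_def by (rule inf_inclusion_order)
  have join: "I \<squnion>\<^bsub>t_s C\<^esub> J = semiprime_hull C (I \<union> J)" if "I \<in> ?T" "J \<in> ?T" for I J
    using sup[OF that] unfolding join_def t_s_def by (rule sup_inclusion_order)
  have car: "carrier (t_s C) = ?T" by (simp add: t_s_def)
  interpret partial_order "t_s C" by (simp add: t_s_def partial_order_inclusion_order)
  show ?thesis
  proof (unfold_locales, unfold car)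
    fix I J assume "I \<in> ?T" "J \<in> ?T"
    then show "\<exists>s. least (t_s C) s (Upper (t_s C) {I, J})" "\<exists>s. greatest (t_s C) s (Lower (t_s C) {I, J})"
      using inf sup by blast+
  next
    \<comment> \<open>The zero object lies in every prime and generates the bottom; the unit lies in
      none and generates the top.\<close>
    obtain Z where "zero_object C Z" using zero_object_exists by blast
    then have "Z \<in> Obj C" "\<And>P. P \<in> Spc C \<Longrightarrow> Z \<in> P" using prime_zero by (auto simp: zero_object_def)
    then have "least (t_s C) (semiprime_hull C {Z}) ?T"
      unfolding least_def t_s_def principal_semiprimes_eq by (auto simp: semiprime_hull_iff)
    then show "\<exists>x. least (t_s C) x ?T" by blast
  next
    have "greatest (t_s C) (semiprime_hull C {UnitO C}) ?T"
      using UnitO_in UnitO_notin_prime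
      unfolding greatest_def t_s_def principal_semiprimes_eq by (auto simp: semiprime_hull_iff)
    then show "\<exists>x. greatest (t_s C) x ?T" by blast
  next
    fix I J L assume I: "I \<in> ?T" and J: "J \<in> ?T" and L: "L \<in> ?T"
    have "I \<inter> semiprime_hull C (J \<union> L) = semiprime_hull C ((I \<inter> J) \<union> (I \<inter> L))" (is "?l = ?r")
    proof (rule subset_antisym)
      show "?r \<subseteq> ?l"
        using semiprime_hull_least[OF sp[OF I], of "(I \<inter> J) \<union> (I \<inter> L)"]
          semiprime_hull_mono[of "(I \<inter> J) \<union> (I \<inter> L)" "J \<union> L"] by blast
      show "?l \<subseteq> ?r"
      proof
        fix X assume X: "X \<in> ?l"
        \<comment> \<open>By \<open>prime_Int\<close>, \<open>P\<close> contains \<open>I\<close> or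
          else both \<open>J\<close> and \<open>L\<close>.\<close>
        have "X \<in> P" if P: "P \<in> Spc C" and sub: "(I \<inter> J) \<union> (I \<inter> L) \<subseteq> P" for P
          using prime_Int[OF P sp[OF I] sp[OF J]] prime_Int[OF P sp[OF I] sp[OF L]] sub X P
          by (auto simp: semiprime_hull_iff)
        then show "X \<in> ?r" using X by (auto simp: semiprime_hull_iff)
      qed
    qed
    then show "I \<sqinter>\<^bsub>t_s C\<^esub> (J \<squnion>\<^bsub>t_s C\<^esub> L) = (I \<sqinter>\<^bsub>t_s C\<^esub> J) \<squnion>\<^bsub>t_s C\<^esub> (I \<sqinter>\<^bsub>t_s C\<^esub> L)"
      using I J L Int Join meet join by simp
  qed
qed

text \<open>A meet in \<open>t_s C\<close> is a priori only the largest principal ideal below both.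
  It is the whole intersection because each object of the intersection generates a principal ideal
  below both.\<close>

lemma lattice_imp_principal_closure:
  assumes "bounded_distributive_lattice (t_s C)"
  shows "principal_closure C"
  unfolding principal_closure_def
proof (intro ballI)
  interpret bounded_distributive_lattice "t_s C" by fact
  fix X Y assume X: "X \<in> Obj C" and Y: "Y \<in> Obj C"
  let ?h = "\<lambda>X. semiprime_hull C {X}"
  have car: "carrier (t_s C) = ?h ` Obj C" by (simp add: t_s_def principal_semiprimes_eq)
  have "?h X \<in> carrier (t_s C)" "?h Y \<in> carrier (t_s C)" using X Y car by simp_all
  then obtain I where I: "greatest (t_s C) I (Lower (t_s C) {?h X, ?h Y})"
    using inf_of_two_exists by meson
  then have "I \<in> carrier (t_s C)" "I \<subseteq> ?h X" "I \<subseteq> ?h Y"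
    using X Y car unfolding greatest_def Lower_def t_s_def by auto
  then obtain Z where Z: "Z \<in> Obj C" "I = ?h Z" using car by blast
  have "W \<in> I" if "W \<in> ?h X \<inter> ?h Y" for W
  proof -
    have W: "W \<in> Obj C" using that by (auto simp: semiprime_hull_iff)
    have "?h W \<subseteq> ?h X" "?h W \<subseteq> ?h Y" using that by (simp_all add: semiprime_hull_least semiprime_hull_in)
    then have "?h W \<in> Lower (t_s C) {?h X, ?h Y}"
      using W car unfolding Lower_def t_s_def by auto
    then have "?h W \<subseteq> I" using I unfolding greatest_def t_s_def by auto
    then show ?thesis using W subset_semiprime_hull[of "{W}"] by blast
  qed
  then have "?h X \<inter> ?h Y = ?h Z" using \<open>I \<subseteq> ?h X\<close> \<open>I \<subseteq> ?h Y\<close> Z by blast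
  with Z(1) show "\<exists>Z \<in> Obj C. semiprime_gen C X \<inter> semiprime_gen C Y = semiprime_gen C Z"
    using X Y semiprime_gen_eq_hull by auto
qed

end

section \<open>The spectrum\<close>

text \<open>Otherwise Zorn gives an open \<open>M\<close> maximal among those that contain
  \<open>U\<close> but no member of \<open>\<D>\<close>. Its complement is irreducible, and the
  generic point lies in every member of \<open>\<D>\<close>, hence in
  \<open>U \<subseteq> M\<close>, which is absurd.\<close>

lemma sober_space_filtered_compact_opens:
  assumes sober: "sober_space X" and ne: "\<D> \<noteq> {}"
    and D: "\<And>D. D \<in> \<D> \<Longrightarrow> openin X D" "\<And>D. D \<in> \<D> \<Longrightarrow> compactin X D"
    and filtered: "\<And>D E. D \<in> \<D> \<Longrightarrow> E \<in> \<D> \<Longrightarrow> \<exists>F \<in> \<D>. F \<subseteq> D \<inter> E"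
    and U: "openin X U" "\<Inter>\<D> \<subseteq> U"
  shows "\<exists>D \<in> \<D>. D \<subseteq> U"
proof (rule ccontr)
  assume no: "\<not> ?thesis"
  define \<A> where "\<A> = {V. openin X V \<and> U \<subseteq> V \<and> (\<forall>D \<in> \<D>. \<not> D \<subseteq> V)}"
  have "\<exists>M \<in> \<A>. \<forall>V \<in> \<A>. M \<subseteq> V \<longrightarrow> V = M"
  proof (rule subset_Zorn_nonempty)
    show "\<A> \<noteq> {}" using U no by (auto simp: \<A>_def)
    fix \<C> assume \<C>: "\<C> \<noteq> {}" "subset.chain \<A> \<C>"
    then have C\<A>: "\<C> \<subseteq> \<A>" by (auto simp: subset.chain_def)
    \<comment> \<open>By compactness finitely many members of the chain would cover
      \<open>D\<close>, and then the largest of them alone.\<close>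
    have "\<not> D \<subseteq> \<Union>\<C>" if DD: "D \<in> \<D>" for D
    proof
      assume "D \<subseteq> \<Union>\<C>"
      moreover have "\<And>V. V \<in> \<C> \<Longrightarrow> openin X V" using C\<A> by (auto simp: \<A>_def)
      ultimately obtain \<F> where \<F>: "finite \<F>" "\<F> \<subseteq> \<C>" "D \<subseteq> \<Union>\<F>"
        using compactinD[OF D(2)[OF DD]] by metis
      \<comment> \<open>\<open>V\<close> makes the finite chain nonempty, so that it has a largest
        member.\<close>
      obtain V where V: "V \<in> \<C>" using \<C>(1) by blast
      have "subset.chain \<A> (insert V \<F>)"
        using \<C>(2) \<F>(2) V unfolding subset.chain_def by (meson insert_subset subset_iff)
      then have "\<Union>(insert V \<F>) \<in> insert V \<F>" using Union_in_chain[of "insert V \<F>"] \<F>(1) by blast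
      moreover have "insert V \<F> \<subseteq> \<A>" using C\<A> \<F>(2) V by blast
      ultimately have "\<Union>(insert V \<F>) \<in> \<A>" by (rule subsetD[rotated])
      then show False using DD \<F>(3) by (auto simp: \<A>_def)
    qed
    then show "\<Union>\<C> \<in> \<A>" using C\<A> \<C>(1) by (auto simp: \<A>_def)
  qed
  then obtain M where M: "openin X M" "U \<subseteq> M" "\<And>D. D \<in> \<D> \<Longrightarrow> \<not> D \<subseteq> M"
    and max: "\<And>V. openin X V \<Longrightarrow> M \<subseteq> V \<Longrightarrow> \<forall>D \<in> \<D>. \<not> D \<subseteq> V \<Longrightarrow> V = M"
    unfolding \<A>_def by auto
  define A where "A = topspace X - M"
  have meets: "D \<inter> A \<noteq> {}" if "D \<in> \<D>" for D
    using M(3)[OF that] openin_subset[OF D(1)[OF that]] by (auto simp: A_def)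
  have "irreducible_closedin X A"
    unfolding irreducible_closedin_def
  proof (intro conjI allI impI)
    show "closedin X A" using M(1) by (auto simp: A_def)
    show "A \<noteq> {}" using meets ne by blast
    fix F G assume FG: "closedin X F \<and> closedin X G \<and> A = F \<union> G"
    \<comment> \<open>The complement of \<open>H\<close> is open and strictly larger than
      \<open>M\<close>, so by maximality it contains a member of \<open>\<D>\<close>.\<close>
    have proper: "\<exists>D \<in> \<D>. D \<inter> H = {}" if H: "closedin X H" "H \<subseteq> A" "A \<noteq> H" for H
    proof -
      have "topspace X - H \<noteq> M" using H closedin_subset[OF H(1)] by (auto simp: A_def)
      moreover have "M \<subseteq> topspace X - H" using H(2) openin_subset[OF M(1)] by (auto simp: A_def)
      ultimately show ?thesis using max[of "topspace X - H"] H(1) by blast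
    qed
    show "A = F \<or> A = G"
    proof (rule ccontr)
      assume "\<not> (A = F \<or> A = G)"
      then obtain D E where "D \<in> \<D>" "E \<in> \<D>" "D \<inter> F = {}" "E \<inter> G = {}"
        using proper[of F] proper[of G] FG by blast
      then obtain H where "H \<in> \<D>" "H \<inter> A = {}" using filtered[of D E] FG by blast
      then show False using meets by blast
    qed
  qed
  then obtain x where x: "x \<in> topspace X" "X closure_of {x} = A"
    using sober unfolding sober_space_def by metis
  \<comment> \<open>An open set that meets the closure of \<open>{x}\<close> contains
    \<open>x\<close>.\<close>
  have "x \<in> D" if "D \<in> \<D>" for D
    using meets[OF that] D(1)[OF that] x(2) by (auto simp: in_closure_of)
  then have "x \<in> M" using U(2) M(2) by blast
  moreover have "x \<in> A" using x closure_of_subset[of "{x}" X] by auto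
  ultimately show False by (simp add: A_def)
qed

context monoidal_triangulated_category
begin

section \<open>Basic open sets and closures of points\<close>

lemma complement_supp: "Spc C - supp C X = {P \<in> Spc C. X \<in> P}"
  by (auto simp: supp_def)

lemma openin_Spc_space_iff:
  "openin (Spc_space C) U \<longleftrightarrow>
     U \<subseteq> Spc C \<and> (\<forall>P \<in> U. \<exists>X \<in> Obj C. X \<in> P \<and> {Q \<in> Spc C. X \<in> Q} \<subseteq> U)"
proof -
  have "openin (Spc_space C) U \<longleftrightarrow>
     (\<forall>P \<in> U. \<exists>X \<in> Obj C. P \<in> {Q \<in> Spc C. X \<in> Q} \<and> {Q \<in> Spc C. X \<in> Q} \<subseteq> U)"
    unfolding openin_Spc_space arbitrary_union_of_alt complement_supp
    by (intro ball_cong refl) blast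
  then show ?thesis by auto
qed

lemma openin_complement_supp: "X \<in> Obj C \<Longrightarrow> openin (Spc_space C) {P \<in> Spc C. X \<in> P}"
  by (auto simp: openin_Spc_space_iff)

text \<open>Specialisations are the smaller primes, opposite to the Zariski spectrum of a ring: the
  primes containing a fixed object form an open set here, not a closed one.\<close>

lemma closure_of_prime:
  assumes "P \<in> Spc C"
  shows "Spc_space C closure_of {P} = {Q \<in> Spc C. Q \<subseteq> P}"
proof (intro subset_antisym subsetI)
  fix Q assume Q: "Q \<in> Spc_space C closure_of {P}"
  then have QS: "Q \<in> Spc C" by (simp add: in_closure_of topspace_Spc_space)
  have specialization: "\<And>T. Q \<in> T \<Longrightarrow> openin (Spc_space C) T \<Longrightarrow> P \<in> T"
    using Q by (simp add: in_closure_of)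
  have "X \<in> P" if "X \<in> Q" for X
  proof -
    have "X \<in> Obj C" using that thick_subcategoryD(1)[OF SpcD(3)[OF QS]] by blast
    from specialization[OF _ openin_complement_supp[OF this]] show ?thesis using that QS by simp
  qed
  then show "Q \<in> {Q \<in> Spc C. Q \<subseteq> P}" using QS by blast
next
  fix Q assume "Q \<in> {Q \<in> Spc C. Q \<subseteq> P}"
  then show "Q \<in> Spc_space C closure_of {P}"
    using assms by (fastforce simp: in_closure_of topspace_Spc_space openin_Spc_space_iff)
qed

lemma t0_space_Spc: "t0_space (Spc_space C)"
  unfolding t0_space_def topspace_Spc_space
proof (intro ballI impI)
  fix P Q assume P: "P \<in> Spc C" and Q: "Q \<in> Spc C" and "P \<noteq> Q"
  then obtain X where X: "X \<in> P \<longleftrightarrow> X \<notin> Q" by blast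
  then have "X \<in> Obj C" using P Q thick_subcategoryD(1)[OF SpcD(3)] by blast
  then show "\<exists>U. openin (Spc_space C) U \<and> (P \<notin> U \<longleftrightarrow> Q \<in> U)"
    using openin_complement_supp X P Q by blast
qed

text \<open>One \<open>S\<close> serves all primes, where \<open>prime_tensor_elements\<close> asks
  for every \<open>S\<close>. Principal closure supplies the \<open>Z\<close> for
  \<open>finitary_imp_tensor\<close>.\<close>

lemma tensor_detection:
  assumes "hull_finitary C" "principal_closure C" "X \<in> Obj C" "Y \<in> Obj C"
  shows "\<exists>S \<in> Obj C. \<forall>P \<in> Spc C. X \<odot> S \<odot> Y \<in> P \<longrightarrow> X \<in> P \<or> Y \<in> P"
proof -
  obtain Z where Z: "Z \<in> Obj C" "\<And>P. P \<in> Spc C \<Longrightarrow> Z \<in> P \<longleftrightarrow> X \<in> P \<or> Y \<in> P"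
    using assms(2-4) unfolding principal_closure_iff by metis
  have "\<exists>S \<in> Obj C. \<forall>P \<in> Spc C. X \<odot> S \<odot> Y \<in> P \<longrightarrow> Z \<in> P"
    by (rule finitary_imp_tensor[OF assms(1,3,4) Z(1)]) (simp add: Z(2))
  then show ?thesis by (simp add: Z(2) cong: ball_cong)
qed

section \<open>Compact open sets and spectrality\<close>

lemma compactin_complement_supp:
  assumes fin: "hull_finitary C" and pc: "principal_closure C" and X: "X \<in> Obj C"
  shows "compactin (Spc_space C) {P \<in> Spc C. X \<in> P}"
  unfolding compactin_def topspace_Spc_space
proof (intro conjI allI impI)
  let ?D = "\<lambda>X. {P \<in> Spc C. X \<in> P}"
  fix \<U> assume \<U>: "(\<forall>U \<in> \<U>. openin (Spc_space C) U) \<and> ?D X \<subseteq> \<Union>\<U>"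
  \<comment> \<open>\<open>B\<close> collects the objects whose basic open set lies in one member of
    the cover, \<open>F\<close> those whose basic open set is covered by finitely many from
    \<open>B\<close>.\<close>
  define B where "B = {Y \<in> Obj C. \<exists>U \<in> \<U>. ?D Y \<subseteq> U}"
  define F where "F = {Z \<in> Obj C. \<exists>B' \<subseteq> B. finite B' \<and> (\<forall>P \<in> Spc C. Z \<in> P \<longrightarrow> (\<exists>Y \<in> B'. Y \<in> P))}"
  show "\<exists>\<F>. finite \<F> \<and> \<F> \<subseteq> \<U> \<and> ?D X \<subseteq> \<Union>\<F>"
  proof (cases "semiprime_hull C {X} \<inter> F = {}")
    \<comment> \<open>A \<open>Z\<close> in \<open>F\<close> and in the hull of \<open>X\<close>
      gives \<open>D(X) \<subseteq> D(Z)\<close>, hence a finite subcover.\<close>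
    case False
    then obtain Z where Z: "Z \<in> semiprime_hull C {X}" "Z \<in> F" by blast
    obtain B' where B': "B' \<subseteq> B" "finite B'" "\<forall>P \<in> Spc C. Z \<in> P \<longrightarrow> (\<exists>Y \<in> B'. Y \<in> P)"
      using Z(2) unfolding F_def by (elim CollectE conjE exE)
    have "\<forall>Y \<in> B'. \<exists>U \<in> \<U>. ?D Y \<subseteq> U" using B'(1) by (auto simp: B_def)
    then obtain u where u: "\<And>Y. Y \<in> B' \<Longrightarrow> u Y \<in> \<U>" "\<And>Y. Y \<in> B' \<Longrightarrow> ?D Y \<subseteq> u Y" by metis
    have "?D X \<subseteq> \<Union>(u ` B')"
    proof
      fix P assume P: "P \<in> ?D X"
      then have "Z \<in> P" using Z(1) by (auto simp: semiprime_hull_iff)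
      then show "P \<in> \<Union>(u ` B')" using B'(3) P u(2) by blast
    qed
    then show ?thesis using u(1) B'(2) by (intro exI[of _ "u ` B'"]) auto
  next
    \<comment> \<open>Now some prime in \<open>D(X)\<close> avoids \<open>F\<close>. The cover
      member around it contains a basic neighbourhood \<open>D(Y)\<close>, so \<open>Y\<close> lies
      both in that prime and in \<open>F\<close>.\<close>
    case True
    have "thick_ideal C (semiprime_hull C {X})"
      using semiprime_hull_in[of "{X}"] by (simp add: semiprimes_def semiprime_ideal_def)
    then obtain P where P: "P \<in> Spc C" "semiprime_hull C {X} \<subseteq> P" "P \<inter> F = {}"
    proof (rule prime_avoiding_exists[OF _ True])
      \<comment> \<open>No prime contains the unit, so the empty subset of \<open>B\<close>
        suffices.\<close>
      have "UnitO C \<in> F"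
        using UnitO_in UnitO_notin_prime unfolding F_def by (intro CollectI conjI exI[of _ "{}"]) auto
      then show "F \<noteq> {}" by blast
      show "F \<subseteq> Obj C" by (auto simp: F_def)
      fix I J P
      assume I: "thick_ideal C I" and IJ: "tensor_set C I J \<subseteq> P" and "I \<inter> F \<noteq> {}" "J \<inter> F \<noteq> {}"
      then obtain Z W where Z: "Z \<in> I" "Z \<in> F" and W: "W \<in> J" "W \<in> F" by blast
      obtain B1 where B1: "B1 \<subseteq> B" "finite B1" "\<forall>P \<in> Spc C. Z \<in> P \<longrightarrow> (\<exists>Y \<in> B1. Y \<in> P)"
        using Z(2) unfolding F_def by (elim CollectE conjE exE)
      obtain B2 where B2: "B2 \<subseteq> B" "finite B2" "\<forall>P \<in> Spc C. W \<in> P \<longrightarrow> (\<exists>Y \<in> B2. Y \<in> P)"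
        using W(2) unfolding F_def by (elim CollectE conjE exE)
      have O: "Z \<in> Obj C" "W \<in> Obj C" using Z W by (auto simp: F_def)
      \<comment> \<open>\<open>D(Z \<odot> S \<odot> W)\<close> lies in
        \<open>D(Z) \<union> D(W)\<close>, which \<open>B1\<close> and \<open>B2\<close> cover
        together.\<close>
      obtain S where S: "S \<in> Obj C" "\<forall>P \<in> Spc C. Z \<odot> S \<odot> W \<in> P \<longrightarrow> Z \<in> P \<or> W \<in> P"
        using tensor_detection[OF fin pc O] by (elim bexE)
      have "\<exists>Y \<in> B1 \<union> B2. Y \<in> P" if "P \<in> Spc C" "Z \<odot> S \<odot> W \<in> P" for P
        using bspec[OF S(2) that(1)] that(2) bspec[OF B1(3) that(1)] bspec[OF B2(3) that(1)] by blast
      moreover have "Z \<odot> S \<odot> W \<in> Obj C" using O S(1) TensorO_in by simp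
      moreover have "B1 \<union> B2 \<subseteq> B" "finite (B1 \<union> B2)" using B1 B2 by auto
      ultimately have "Z \<odot> S \<odot> W \<in> F"
        unfolding F_def by (intro CollectI conjI exI[of _ "B1 \<union> B2"]) blast+
      moreover have "Z \<odot> S \<odot> W \<in> P"
        using IJ thick_idealD(2)[OF I Z(1) S(1)] W(1) by (simp add: tensor_set_subset_iff)
      ultimately show "P \<inter> F \<noteq> {}" by blast
    qed
    have "X \<in> P" using P(2) subset_semiprime_hull[of "{X}"] X by blast
    then obtain U where U: "U \<in> \<U>" "P \<in> U" using \<U> P(1) by blast
    then obtain Y where Y: "Y \<in> Obj C" "Y \<in> P" "?D Y \<subseteq> U"
      using \<U> unfolding openin_Spc_space_iff by meson
    then have "Y \<in> B" using U(1) by (auto simp: B_def)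
    then have "Y \<in> F" using Y(1) unfolding F_def by (intro CollectI conjI exI[of _ "{Y}"]) simp_all
    then show ?thesis using P(3) Y(2) by blast
  qed
qed blast

lemma finite_meet_exists:
  assumes pc: "principal_closure C" and "finite A" "A \<subseteq> Obj C"
  shows "\<exists>Z \<in> Obj C. \<forall>P \<in> Spc C. Z \<in> P \<longleftrightarrow> (\<exists>X \<in> A. X \<in> P)"
  using assms(2,3)
proof (induction rule: finite_induct)
  case empty
  \<comment> \<open>The unit represents the empty union of basic open sets.\<close>
  show ?case using UnitO_in UnitO_notin_prime by blast
next
  case (insert X A)
  then obtain Z where Z: "Z \<in> Obj C" "\<forall>P \<in> Spc C. Z \<in> P \<longleftrightarrow> (\<exists>X \<in> A. X \<in> P)" by auto
  obtain W where "W \<in> Obj C" "\<forall>P \<in> Spc C. W \<in> P \<longleftrightarrow> X \<in> P \<or> Z \<in> P"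
    using pc insert.prems Z(1) unfolding principal_closure_iff by auto metis
  with Z(2) show ?case by (intro bexI[of _ W]) simp_all
qed

text \<open>A compact open set is a finite union of basic open sets, and principal closure merges
  these into one.\<close>

lemma compact_opens_Spc:
  assumes fin: "hull_finitary C" and pc: "principal_closure C"
  shows "compact_opens (Spc_space C) = {{P \<in> Spc C. X \<in> P} | X. X \<in> Obj C}"
proof (intro subset_antisym subsetI)
  let ?D = "\<lambda>X. {P \<in> Spc C. X \<in> P}"
  fix U assume U: "U \<in> compact_opens (Spc_space C)"
  then have op: "openin (Spc_space C) U" and co: "compactin (Spc_space C) U"
    by (auto simp: compact_opens_def)
  define \<B> where "\<B> = ?D ` {X \<in> Obj C. ?D X \<subseteq> U}"
  have "U \<subseteq> \<Union>\<B>"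
  proof
    fix P assume P: "P \<in> U"
    then obtain X where "X \<in> Obj C" "X \<in> P" "?D X \<subseteq> U" and "P \<in> Spc C"
      using op unfolding openin_Spc_space_iff by blast
    then show "P \<in> \<Union>\<B>" unfolding \<B>_def by blast
  qed
  moreover have "\<And>V. V \<in> \<B> \<Longrightarrow> openin (Spc_space C) V"
    using openin_complement_supp by (auto simp: \<B>_def)
  ultimately obtain \<F> where \<F>: "finite \<F>" "\<F> \<subseteq> \<B>" "U \<subseteq> \<Union>\<F>"
    using compactinD[OF co] by metis
  then obtain A where A: "A \<subseteq> {X \<in> Obj C. ?D X \<subseteq> U}" "finite A" "\<F> = ?D ` A"
    unfolding \<B>_def by (meson finite_subset_image)
  have "A \<subseteq> Obj C" using A(1) by blast
  then obtain Z where Z: "Z \<in> Obj C" "\<forall>P \<in> Spc C. Z \<in> P \<longleftrightarrow> (\<exists>X \<in> A. X \<in> P)"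
    using finite_meet_exists[OF pc A(2)] by blast
  have "U = \<Union>(?D ` A)" using A(1,3) \<F>(3) by blast
  also have "\<dots> = ?D Z" using Z(2) by auto
  finally show "U \<in> {?D X | X. X \<in> Obj C}" using Z(1) by blast
next
  fix U assume "U \<in> {{P \<in> Spc C. X \<in> P} | X. X \<in> Obj C}"
  then show "U \<in> compact_opens (Spc_space C)"
    using openin_complement_supp compactin_complement_supp[OF fin pc] by (auto simp: compact_opens_def)
qed

lemma sober_space_Spc:
  assumes fin: "hull_finitary C" and pc: "principal_closure C"
  shows "sober_space (Spc_space C)"
  unfolding sober_space_def topspace_Spc_space
proof (intro allI impI)
  let ?D = "\<lambda>X. {P \<in> Spc C. X \<in> P}"
  fix A assume irr: "irreducible_closedin (Spc_space C) A"
  then have cl: "closedin (Spc_space C) A" and ne: "A \<noteq> {}"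
    and un: "\<And>F G. closedin (Spc_space C) F \<Longrightarrow> closedin (Spc_space C) G \<Longrightarrow> A = F \<union> G \<Longrightarrow> A = F \<or> A = G"
    by (auto simp: irreducible_closedin_def)
  have AS: "A \<subseteq> Spc C" using closedin_subset[OF cl] by (simp add: topspace_Spc_space)
  \<comment> \<open>Nonempty open subsets of an irreducible set meet; this is the directedness that
    \<open>thick_ideal_Union\<close> asks for.\<close>
  have both: "\<exists>P \<in> A. X \<in> P \<and> Y \<in> P" if "X \<in> \<Union>A" "Y \<in> \<Union>A" for X Y
  proof (rule ccontr)
    assume no: "\<not> ?thesis"
    have "X \<in> Obj C" "Y \<in> Obj C" using that AS thick_subcategoryD(1)[OF SpcD(3)] by blast+
    then have "closedin (Spc_space C) (A - ?D X)" "closedin (Spc_space C) (A - ?D Y)"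
      using closedin_diff[OF cl openin_complement_supp] by auto
    moreover have "A = (A - ?D X) \<union> (A - ?D Y)" using no by blast
    ultimately have "A = A - ?D X \<or> A = A - ?D Y" by (rule un)
    then show False using that AS by blast
  qed
  define P where "P = \<Union>A"
  have thick: "thick_ideal C P"
    unfolding P_def using thick_ideal_Union[OF ne] SpcD(1) AS both by blast
  have "prime_ideal C P"
    unfolding prime_ideal_def
  proof (intro conjI allI impI thick)
    have "UnitO C \<notin> P" using UnitO_notin_prime AS unfolding P_def by blast
    then show "P \<noteq> Obj C" using UnitO_in by blast
    fix I J assume IJ: "thick_ideal C I \<and> thick_ideal C J \<and> tensor_set C I J \<subseteq> P"
    show "I \<subseteq> P \<or> J \<subseteq> P"
    proof (rule ccontr)
      assume "\<not> (I \<subseteq> P \<or> J \<subseteq> P)"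
      then obtain X Y where XY: "X \<in> I" "X \<notin> P" "Y \<in> J" "Y \<notin> P" by blast
      have O: "X \<in> Obj C" "Y \<in> Obj C" using IJ XY thick_idealD(1) thick_subcategoryD(1) by blast+
      \<comment> \<open>Different \<open>S\<close> could put \<open>X \<odot> S \<odot> Y\<close>
        into different members of \<open>A\<close>; the detecting \<open>S\<close> makes one product
        in one member enough.\<close>
      obtain S where S: "S \<in> Obj C" "\<forall>P \<in> Spc C. X \<odot> S \<odot> Y \<in> P \<longrightarrow> X \<in> P \<or> Y \<in> P"
        using tensor_detection[OF fin pc O] by (elim bexE)
      have "X \<odot> S \<in> I" by (rule thick_idealD(2)[OF conjunct1[OF IJ] XY(1) S(1)])
      then have "X \<odot> S \<odot> Y \<in> P" using IJ XY(3) by (auto simp: tensor_set_subset_iff)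
      then obtain Q where Q: "Q \<in> A" "X \<odot> S \<odot> Y \<in> Q" unfolding P_def by blast
      then have "X \<in> Q \<or> Y \<in> Q" using bspec[OF S(2), of Q] AS by auto
      then show False using Q(1) XY unfolding P_def by blast
    qed
  qed
  then have PS: "P \<in> Spc C" by (simp add: Spc_def)
  have "{Q \<in> Spc C. Q \<subseteq> P} = A"
  proof (intro subset_antisym subsetI)
    fix Q assume Q: "Q \<in> {Q \<in> Spc C. Q \<subseteq> P}"
    show "Q \<in> A"
    proof (rule ccontr)
      \<comment> \<open>A basic neighbourhood of \<open>Q\<close> misses \<open>A\<close>, but its
        object lies in \<open>Q \<subseteq> \<Union>A\<close>, hence in a member of
        \<open>A\<close>.\<close>
      assume "Q \<notin> A"
      moreover have "openin (Spc_space C) (Spc C - A)"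
        using cl by (simp add: closedin_def topspace_Spc_space)
      ultimately obtain X where "X \<in> Q" "?D X \<subseteq> Spc C - A"
        using Q unfolding openin_Spc_space_iff by blast
      then show False using Q AS unfolding P_def by blast
    qed
  qed (use AS in \<open>auto simp: P_def\<close>)
  then have "Spc_space C closure_of {P} = A" using closure_of_prime[OF PS] by simp
  \<comment> \<open>Primes with the same closure contain each other.\<close>
  moreover have "Q = P" if "Q \<in> Spc C" "Spc_space C closure_of {Q} = A" for Q
    using that calculation closure_of_prime[OF PS] closure_of_prime[OF that(1)] PS by blast
  ultimately show "\<exists>!P. P \<in> Spc C \<and> Spc_space C closure_of {P} = A" using PS by blast
qed

lemma spectral_space_Spc:
  assumes fin: "hull_finitary C" and pc: "principal_closure C"
  shows "spectral_space (Spc_space C)"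
  unfolding spectral_space_def
proof (intro conjI ballI)
  let ?D = "\<lambda>X. {P \<in> Spc C. X \<in> P}"
  note co = compact_opens_Spc[OF fin pc]
  \<comment> \<open>The zero object makes the whole spectrum a basic open set.\<close>
  obtain Z where Z: "zero_object C Z" using zero_object_exists by blast
  then have "?D Z = Spc C" "Z \<in> Obj C" using prime_zero by (auto simp: zero_object_def)
  then show "compact_space (Spc_space C)"
    using compactin_complement_supp[OF fin pc, of Z] by (simp add: compact_space_def topspace_Spc_space)
  show "openin (Spc_space C) = arbitrary union_of (\<lambda>U. U \<in> compact_opens (Spc_space C))"
    unfolding openin_Spc_space co complement_supp by (rule arg_cong[where f = "(union_of) arbitrary"]) blast
  fix U V assume "U \<in> compact_opens (Spc_space C)" "V \<in> compact_opens (Spc_space C)"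
  then obtain X Y where XY: "X \<in> Obj C" "U = ?D X" "Y \<in> Obj C" "V = ?D Y" unfolding co by blast
  obtain S where S: "is_direct_sum C X Y S" using direct_sum_exists XY by blast
  have "U \<inter> V = ?D S" using prime_direct_sum[OF _ S] XY by auto
  then show "U \<inter> V \<in> compact_opens (Spc_space C)"
    unfolding co using direct_sum_objects(3)[OF S] by blast
qed (rule t0_space_Spc sober_space_Spc[OF fin pc])+

section \<open>From the spectrum back to principal closure and compact detection\<close>

lemma spectral_imp_principal_closure:
  assumes co: "compact_opens (Spc_space C) = {{P \<in> Spc C. X \<in> P} | X. X \<in> Obj C}"
  shows "principal_closure C"
  unfolding principal_closure_iff
proof (intro ballI)
  let ?D = "\<lambda>X. {P \<in> Spc C. X \<in> P}"
  fix X Y assume "X \<in> Obj C" "Y \<in> Obj C"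
  then have "?D X \<in> compact_opens (Spc_space C)" "?D Y \<in> compact_opens (Spc_space C)"
    unfolding co by blast+
  \<comment> \<open>Compact open sets are closed under binary unions, and by \<open>co\<close> the
    union is again basic.\<close>
  then have "?D X \<union> ?D Y \<in> compact_opens (Spc_space C)"
    by (auto simp: compact_opens_def compactin_Un)
  then obtain Z where "Z \<in> Obj C" "?D X \<union> ?D Y = ?D Z" unfolding co by blast
  then show "\<exists>Z \<in> Obj C. \<forall>P \<in> Spc C. Z \<in> P \<longleftrightarrow> X \<in> P \<or> Y \<in> P" by (intro bexI[of _ Z]) auto
qed

text \<open>The sets \<open>D(X \<odot> S \<odot> X)\<close> are filtered, since direct sums of the
  \<open>S\<close> give common refinements. Their intersection lies in \<open>D(X)\<close> by
  primeness, so a single one does.\<close>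

lemma sober_imp_compact_detection:
  assumes sober: "sober_space (Spc_space C)"
    and co: "compact_opens (Spc_space C) = {{P \<in> Spc C. X \<in> P} | X. X \<in> Obj C}"
  shows "compact_detection C"
  unfolding compact_detection_iff
proof
  let ?D = "\<lambda>X. {P \<in> Spc C. X \<in> P}"
  fix X assume X: "X \<in> Obj C"
  define \<D> where "\<D> = (\<lambda>S. ?D (X \<odot> S \<odot> X)) ` Obj C"
  have "\<exists>D \<in> \<D>. D \<subseteq> ?D X"
  proof (rule sober_space_filtered_compact_opens[OF sober])
    show "\<D> \<noteq> {}" using X by (auto simp: \<D>_def)
    have "D \<in> compact_opens (Spc_space C)" if "D \<in> \<D>" for D
      using that X TensorO_in unfolding co \<D>_def by blast
    then show "\<And>D. D \<in> \<D> \<Longrightarrow> openin (Spc_space C) D" "\<And>D. D \<in> \<D> \<Longrightarrow> compactin (Spc_space C) D"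
      by (auto simp: compact_opens_def)
    show "openin (Spc_space C) (?D X)" by (rule openin_complement_supp[OF X])
    show "\<Inter>\<D> \<subseteq> ?D X"
    proof
      fix P assume P: "P \<in> \<Inter>\<D>"
      then have all: "P \<in> ?D (X \<odot> S \<odot> X)" if "S \<in> Obj C" for S
        using that by (auto simp: \<D>_def)
      then have "P \<in> Spc C" using X by blast
      then show "P \<in> ?D X" using prime_tensor_elements[OF _ X X, of P] all by auto
    qed
    fix D E assume "D \<in> \<D>" "E \<in> \<D>"
    then obtain S T where ST: "S \<in> Obj C" "T \<in> Obj C" "D = ?D (X \<odot> S \<odot> X)" "E = ?D (X \<odot> T \<odot> X)"
      by (auto simp: \<D>_def)
    obtain U where U: "is_direct_sum C S T U" using direct_sum_exists ST by blast
    have "?D (X \<odot> U \<odot> X) \<subseteq> D \<inter> E"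
    proof
      fix P assume P: "P \<in> ?D (X \<odot> U \<odot> X)"
      then have "thick_subcategory C {S \<in> Obj C. X \<odot> S \<in> {W \<in> Obj C. W \<odot> X \<in> P}}"
        using X by (intro thick_tensor_inverse_image SpcD(3)) simp_all
      from thick_subcategoryD(3)[OF this U] show "P \<in> D \<inter> E"
        using P ST X TensorO_in direct_sum_objects(3)[OF U] by auto
    qed
    then show "\<exists>F \<in> \<D>. F \<subseteq> D \<inter> E" using direct_sum_objects(3)[OF U] by (auto simp: \<D>_def)
  qed
  then show "\<exists>S \<in> Obj C. \<forall>P \<in> Spc C. X \<odot> S \<odot> X \<in> P \<longrightarrow> X \<in> P" unfolding \<D>_def by blast
qed

section \<open>Semiprime ideals and Thomason subsets\<close>

lemma bij_betw_ideal_support: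
  assumes co: "compact_opens (Spc_space C) = {{P \<in> Spc C. X \<in> P} | X. X \<in> Obj C}"
  shows "bij_betw (ideal_support C) (semiprimes C) (Thomason (Spc_space C))"
proof -
  \<comment> \<open>So the support determines which primes contain \<open>I\<close>, and with them
    the hull of \<open>I\<close>, which is \<open>I\<close> itself if \<open>I\<close> is
    semiprime.\<close>
  have notin: "P \<notin> ideal_support C I \<longleftrightarrow> I \<subseteq> P" if "P \<in> Spc C" for P I
    using that by (auto simp: ideal_support_def supp_def)
  \<comment> \<open>By \<open>co\<close> the building blocks of Thomason subsets are exactly the
    supports of objects.\<close>
  have closed_iff: "closedin (Spc_space C) A \<and> compactin (Spc_space C) (topspace (Spc_space C) - A)
      \<longleftrightarrow> A \<in> supp C ` Obj C" for A
  proof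
    assume A: "closedin (Spc_space C) A \<and> compactin (Spc_space C) (topspace (Spc_space C) - A)"
    then have "Spc C - A \<in> compact_opens (Spc_space C)" "A \<subseteq> Spc C"
      using closedin_subset by (auto simp: compact_opens_def closedin_def topspace_Spc_space)
    then obtain X where "X \<in> Obj C" "Spc C - A = {P \<in> Spc C. X \<in> P}" unfolding co by blast
    then have "A = supp C X" using \<open>A \<subseteq> Spc C\<close> by (auto simp: supp_def)
    with \<open>X \<in> Obj C\<close> show "A \<in> supp C ` Obj C" by blast
  next
    assume "A \<in> supp C ` Obj C"
    then obtain X where X: "X \<in> Obj C" "A = supp C X" by blast
    then have "Spc C - A \<in> compact_opens (Spc_space C)" unfolding co X(2) complement_supp by blast
    moreover have "A \<subseteq> Spc C" using X by (auto simp: supp_def)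
    ultimately show "closedin (Spc_space C) A \<and> compactin (Spc_space C) (topspace (Spc_space C) - A)"
      by (simp add: compact_opens_def closedin_def topspace_Spc_space)
  qed
  have Thomason: "Thomason (Spc_space C) = {\<Union>\<F> | \<F>. \<F> \<subseteq> supp C ` Obj C}"
    unfolding Thomason_def closed_iff by (simp add: subset_eq)
  show ?thesis
    unfolding bij_betw_def
  proof
    show "inj_on (ideal_support C) (semiprimes C)"
    proof (rule inj_onI)
      fix I J assume I: "I \<in> semiprimes C" and J: "J \<in> semiprimes C"
        and eq: "ideal_support C I = ideal_support C J"
      have "I \<subseteq> P \<longleftrightarrow> J \<subseteq> P" if "P \<in> Spc C" for P using notin[OF that] eq by metis
      then have "semiprime_hull C I = semiprime_hull C J" by (simp add: semiprime_hull_def cong: conj_cong)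
      then show "I = J" using semiprime_hull_semiprime I J by metis
    qed
    show "ideal_support C ` semiprimes C = Thomason (Spc_space C)"
    proof (intro subset_antisym subsetI)
      fix W assume "W \<in> ideal_support C ` semiprimes C"
      then obtain I where "I \<subseteq> Obj C" "W = \<Union>(supp C ` I)"
        using semiprime_subset by (auto simp: ideal_support_def)
      then show "W \<in> Thomason (Spc_space C)" unfolding Thomason by blast
    next
      fix W assume "W \<in> Thomason (Spc_space C)"
      then obtain A where A: "A \<subseteq> Obj C" "W = \<Union>(supp C ` A)"
        unfolding Thomason by (auto simp: subset_image_iff)
      have WS: "W \<subseteq> Spc C" "ideal_support C (semiprime_hull C A) \<subseteq> Spc C"
        using A(2) by (auto simp: supp_def ideal_support_def)
      \<comment> \<open>The hull of \<open>A\<close> is the preimage of \<open>W\<close>: a prime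
        contains it exactly if it contains \<open>A\<close>.\<close>
      have "P \<notin> ideal_support C (semiprime_hull C A) \<longleftrightarrow> P \<notin> W" if P: "P \<in> Spc C" for P
      proof -
        have "P \<notin> ideal_support C (semiprime_hull C A) \<longleftrightarrow> A \<subseteq> P"
          unfolding notin[OF P]
          using subset_semiprime_hull[OF A(1)] semiprime_hull_least[OF prime_semiprime[OF P], of A] by blast
        also have "\<dots> \<longleftrightarrow> P \<notin> W" using P by (auto simp: A(2) supp_def)
        finally show ?thesis .
      qed
      then have "ideal_support C (semiprime_hull C A) = W" using WS by blast
      then show "W \<in> ideal_support C ` semiprimes C" using semiprime_hull_in by blast
    qed
  qed
qed

end

section \<open>Equivalence of the three conditions and the classification of semiprime
  ideals\<close>

theorem theoremB:
  fixes K :: "('o, 'm, 'e) mt_category_scheme"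
  assumes "monoidal_triangulated_category K"
  shows
    "let a = principal_closure K \<and> compact_detection K;
         b = bounded_distributive_lattice (t_s K) \<and> carrier (t_s K) = compact_elements (T_s K);
         c = spectral_space (Spc_space K) \<and>
             compact_opens (Spc_space K) = {Spc K - supp K x | x. x \<in> Obj K}
     in (a \<longleftrightarrow> b) \<and> (b \<longleftrightarrow> c) \<and>
        (a \<or> b \<or> c \<longrightarrow>
           bij_betw (ideal_support K) (carrier (T_s K)) (Thomason (Spc_space K)) \<and>
           mono_on (carrier (T_s K)) (ideal_support K))"
proof -
  interpret monoidal_triangulated_category K by fact
  let ?a = "principal_closure K \<and> compact_detection K"
  let ?b = "bounded_distributive_lattice (t_s K) \<and> carrier (t_s K) = compact_elements (T_s K)"
  let ?c = "spectral_space (Spc_space K) \<and>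
    compact_opens (Spc_space K) = {Spc K - supp K x | x. x \<in> Obj K}"
  have car: "carrier (t_s K) = principal_semiprimes K" "carrier (T_s K) = semiprimes K"
    by (simp_all add: t_s_def T_s_def)
  \<comment> \<open>Finitarity translates the compactness half of (b), and it is equivalent to
    compact detection.\<close>
  have ab: "?a \<longleftrightarrow> ?b"
    unfolding car finitary_iff_compact_elements[symmetric]
    using compact_detection_imp_finitary finitary_imp_compact_detection
      principal_closure_imp_lattice lattice_imp_principal_closure by blast
  have "?a \<longrightarrow> ?c"
    unfolding complement_supp
    using compact_detection_imp_finitary compact_opens_Spc spectral_space_Spc by blast
  moreover have "?c \<longrightarrow> ?a"
    unfolding complement_supp spectral_space_def
    using spectral_imp_principal_closure sober_imp_compact_detection by blast
  \<comment> \<open>The bijection is derived from (c), which (a) and (b) imply.\<close>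
  moreover have "?c \<longrightarrow> bij_betw (ideal_support K) (semiprimes K) (Thomason (Spc_space K))"
    unfolding complement_supp using bij_betw_ideal_support by blast
  moreover have "mono_on (semiprimes K) (ideal_support K)"
    by (auto simp: monotone_on_def ideal_support_def)
  ultimately show ?thesis unfolding Let_def car using ab[unfolded car] by blast
qed

end
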